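(* (1) For every integer $k$ with $4\le k\le 11$ there exists a nearly neighborly centrally symmetric simplicial $3$-sphere with $n=2k$ vertices that has a vertex-transitive cyclic group action. (2) For each $(d,n)\in\{(5,14),(5,16),(7,18)\}$ there exists a nearly neighborly centrally symmetric simplicial $d$-sphere with $n$ vertices that has a vertex-transitive cyclic group action. (3) For each $(d,n)\in\{(4,12),(4,14),(6,16)\}$ there is no nearly neighborly centrally symmetric simplicial $d$-sphere with $n$ vertices that has a vertex-transitive cyclic group action.
   Context: A simplicial $d$-sphere is a finite simplicial complex whose geometric realization is homeomorphic to the sphere $S^d$. A simplicial manifold $M$ is centrally symmetric if it is invariant under an involution $I$ of its vertex set that fixes no (non-empty) face of $M$; then the number of vertices is even, $n=2k$, and after relabeling the vertices by $1,\dots,2k$ one may take $I=(1\;k+1)(2\;k+2)\cdots(k\;2k)$. A centrally symmetric simplicial sphere with $2k$ vertices is centrally $l$-neighborly if every set of $l$ vertices that contains no pair $\{v,I(v)\}$ is a face (equivalently, it contains the $(l-1)$-skeleton of the boundary of the $k$-dimensional crosspolytope). A centrally symmetric simplicial $d$-sphere is nearly neighborly if it is centrally $\lfloor\frac{d+1}{2}\rfloor$-neighborly. A simplicial complex with $n$ vertices has a vertex-transitive cyclic group action if, after labeling its vertices by $1,\dots,n$, the $n$-cycle $(1\,2\,\cdots\,n)$ is an automorphism of the complex; here the central symmetry is $I=(1\,2\,\cdots\,2k)^k=(1\;k+1)\cdots(k\;2k)$ with respect to this labeling. *)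

theory Defs
  imports "HOL-Analysis.Analysis" "HOL-Combinatorics.Cycles"
begin

(* Finite abstract simplicial complexes on an arbitrary vertex type, given by the set of all
   faces including the empty one; every element of vertices K is a face {v}.  The geometric
   simplicial_complex of HOL-Analysis lives in a euclidean space fixed by a type, so it cannot
   carry vertex labels and a number of vertices that varies. *)

definition abstract_complex :: "'a set set \<Rightarrow> bool" where
  "abstract_complex K \<longleftrightarrow>
     finite K \<and> {} \<in> K \<and> (\<forall>F\<in>K. finite F) \<and> (\<forall>F\<in>K. \<forall>G. G \<subseteq> F \<longrightarrow> G \<in> K)"

definition vertices :: "'a set set \<Rightarrow> 'a set" where
  "vertices K = \<Union>K"

(* Barycentric coordinates: all points whose support is a face.  They vanish off the finite set
   vertices K, so the product topology induces the usual topology of the polyhedron. *)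
definition geometric_realization :: "'a set set \<Rightarrow> ('a \<Rightarrow> real) topology" where
  "geometric_realization K =
     subtopology (powertop_real UNIV)
       {x. (\<forall>v. 0 \<le> x v) \<and> {v. x v \<noteq> 0} \<in> K \<and> (\<Sum>v\<in>vertices K. x v) = 1}"

definition simplicial_sphere :: "nat \<Rightarrow> 'a set set \<Rightarrow> bool" where
  "simplicial_sphere d K \<longleftrightarrow>
     abstract_complex K \<and> geometric_realization K homeomorphic_space nsphere d"

definition complex_automorphism :: "'a set set \<Rightarrow> ('a \<Rightarrow> 'a) \<Rightarrow> bool" where
  "complex_automorphism K g \<longleftrightarrow>
     bij_betw g (vertices K) (vertices K) \<and> (\<lambda>F. g ` F) ` K = K"

(* The values of I outside vertices K are irrelevant. *)
definition central_symmetry :: "'a set set \<Rightarrow> ('a \<Rightarrow> 'a) \<Rightarrow> bool" where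
  "central_symmetry K I \<longleftrightarrow>
     complex_automorphism K I \<and>
     (\<forall>v\<in>vertices K. I (I v) = v) \<and>
     (\<forall>F\<in>K. F \<noteq> {} \<longrightarrow> I ` F \<noteq> F)"

definition centrally_neighborly :: "nat \<Rightarrow> 'a set set \<Rightarrow> ('a \<Rightarrow> 'a) \<Rightarrow> bool" where
  "centrally_neighborly l K I \<longleftrightarrow>
     (\<forall>S. S \<subseteq> vertices K \<and> card S = l \<and> (\<forall>v\<in>S. I v \<notin> S) \<longrightarrow> S \<in> K)"

definition nearly_neighborly_cs_sphere ::
    "nat \<Rightarrow> 'a set set \<Rightarrow> ('a \<Rightarrow> 'a) \<Rightarrow> bool" where
  "nearly_neighborly_cs_sphere d K I \<longleftrightarrow>
     simplicial_sphere d K \<and> central_symmetry K I \<and> centrally_neighborly ((d + 1) div 2) K I"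

definition std_cycle :: "nat \<Rightarrow> nat \<Rightarrow> nat" where
  "std_cycle n = cycle_of_list [1..<n + 1]"

(* lab labels the vertices by 1, ..., n.  The n-cycle (1 2 ... n) has to be an automorphism of
   the relabelled complex, and I has to be its power with exponent n / 2 in this labelling
   (n is even whenever I is a central symmetry). *)
definition cyclic_vertex_transitive :: "'a set set \<Rightarrow> ('a \<Rightarrow> 'a) \<Rightarrow> bool" where
  "cyclic_vertex_transitive K I \<longleftrightarrow>
     (let n = card (vertices K) in
      \<exists>lab. bij_betw lab (vertices K) {1..n} \<and>
        complex_automorphism ((\<lambda>F. lab ` F) ` K) (std_cycle n) \<and>
        (\<forall>v\<in>vertices K. lab (I v) = (std_cycle n ^^ (n div 2)) (lab v)))"

end

theory Submission
  imports Defs "HOL-Homology.Homology"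
begin

text \<open>
  Existence. Each sphere is an explicit complex, invariant under the n-cycle, that comes with a
  shelling. A shelling is turned into a sequence of bistellar flips: if B is the union of the first
  facets, B together with the cone over its boundary starts as the boundary of a simplex, and adding
  the next facet F with minimal new face R replaces the star of the face (F - R together with the
  apex) by the star of R. In barycentric coordinates a flip from A to B is the map
  x - min(x|A) (1_A - |A|/|B| 1_B), with the inverse given by the same formula with A and B
  exchanged. After the last facet the cone has disappeared.

  Nonexistence. On an even-dimensional sphere a fixed point free self map has degree -1, so the
  square of any self map has a fixed point. Hence the square of the n-cycle maps some nonempty face
  to itself. If 4 divides n, then the central symmetry is a power of this square and fixes that
  face; for n = 14 the face has at least 7 vertices, too many for a 4-sphere.
\<close>

section \<open>Bistellar flips\<close>

text \<open>The obstacle in the existence part is to show that a complex given by a list of up to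
  630 facets is homeomorphic to a sphere. Shellability reduces this to inclusions between finite
  sets. Capping every partial ball keeps all intermediate complexes spheres of the same dimension,
  so that one kind of homeomorphism serves for all steps, including the last one, where the star of
  the apex is traded for a single facet.

  The flip map needs no case distinction on simplices: A * bd B and bd A * B are the two halves of
  the boundary of the simplex on A \<union> B, and they are projected onto each other along the
  direction from the barycentre of A to that of B. The minimum over A measures how far a point
  travels.

  The parity of d separates the two parts: the antipodal map has degree (-1)^(d+1), which is never a
  square for even d and equals 1 for odd d.\<close>

definition polyhedron :: "'a set set \<Rightarrow> ('a \<Rightarrow> real) set" where
  "polyhedron K = {x. (\<forall>v. 0 \<le> x v) \<and> {v. x v \<noteq> 0} \<in> K \<and> (\<Sum>v\<in>vertices K. x v) = 1}"

text \<open>The topology of the function space is the product topology, so maps between realizations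
  can be handled with \<open>continuous_on\<close>, one coordinate at a time.\<close>

lemma geometric_realization_polyhedron:
  "geometric_realization K = top_of_set (polyhedron K)"
  unfolding geometric_realization_def polyhedron_def
  by (simp add: euclidean_product_topology)

text \<open>A flip may create or delete vertices. Summing over one finite set U that contains the
  vertices of both complexes makes the two sum conditions comparable.\<close>

lemma polyhedron_iff:
  assumes "finite U" "vertices K \<subseteq> U"
  shows "x \<in> polyhedron K \<longleftrightarrow> (\<forall>v. 0 \<le> x v) \<and> {v. x v \<noteq> 0} \<in> K \<and> sum x U = 1"
proof -
  have "sum x (vertices K) = sum x U" if "{v. x v \<noteq> 0} \<in> K"
    using assms that by (intro sum.mono_neutral_left) (auto simp: vertices_def)
  then show ?thesis
    unfolding polyhedron_def by auto
qed

lemma continuous_on_Min_image: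
  fixes f :: "'i \<Rightarrow> 'b::topological_space \<Rightarrow> real"
  assumes "finite A" "A \<noteq> {}" "\<And>a. a \<in> A \<Longrightarrow> continuous_on S (f a)"
  shows "continuous_on S (\<lambda>x. Min ((\<lambda>a. f a x) ` A))"
  using assms
proof (induction A rule: finite_ne_induct)
  case (insert a A)
  then show ?case
    by (simp add: continuous_on_min)
qed simp

lemma continuous_on_coordinate: "continuous_on S (\<lambda>x::'a \<Rightarrow> real. x i)"
  by (rule continuous_on_subset[OF continuous_on_product_coordinates]) simp

text \<open>When B is not a face and the link of A is the boundary of B, this is the bistellar move
  that trades A * bd B for bd A * B.\<close>

definition flip :: "'a set \<Rightarrow> 'a set \<Rightarrow> 'a set set \<Rightarrow> 'a set set" where
  "flip A B K = {F \<in> K. \<not> A \<subseteq> F} \<union> {F. F \<subseteq> A \<union> B \<and> B \<subseteq> F \<and> \<not> A \<subseteq> F}"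

definition flip_map :: "'a set \<Rightarrow> 'a set \<Rightarrow> ('a \<Rightarrow> real) \<Rightarrow> 'a \<Rightarrow> real" where
  "flip_map A B x = (\<lambda>v. if v \<in> A then x v - Min (x ` A)
     else if v \<in> B then x v + real (card A) / real (card B) * Min (x ` A) else x v)"

lemma continuous_on_flip_map:
  assumes "finite A" "A \<noteq> {}"
  shows "continuous_on S (flip_map A B)"
proof (rule continuous_on_coordinatewise_then_product)
  fix v
  have "continuous_on S (\<lambda>x::'a \<Rightarrow> real. Min ((\<lambda>a. x a) ` A))"
    using assms by (intro continuous_on_Min_image continuous_on_coordinate)
  then have "continuous_on S (\<lambda>x. x v + r * Min (x ` A))" for r
    by (intro continuous_intros continuous_on_coordinate)
  from this[of "-1"] this[of "real (card A) / real (card B)"] this[of 0]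
  show "continuous_on S (\<lambda>x. flip_map A B x v)"
    unfolding flip_map_def by (cases "v \<in> A"; cases "v \<in> B") simp_all
qed

lemma Min_image_nonneg:
  assumes "finite A" "A \<noteq> {}" "\<forall>v. 0 \<le> (x v::real)"
  shows "0 \<le> Min (x ` A)" "Min (x ` A) = 0 \<longleftrightarrow> \<not> A \<subseteq> {v. x v \<noteq> 0}"
proof -
  show 0: "0 \<le> Min (x ` A)"
    using assms by simp
  have "Min (x ` A) \<in> x ` A"
    using assms by (intro Min_in) auto
  then obtain a where a: "a \<in> A" "Min (x ` A) = x a"
    by blast
  show "Min (x ` A) = 0 \<longleftrightarrow> \<not> A \<subseteq> {v. x v \<noteq> 0}"
  proof
    assume "Min (x ` A) = 0"
    then show "\<not> A \<subseteq> {v. x v \<noteq> 0}"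
      using a by auto
  next
    assume "\<not> A \<subseteq> {v. x v \<noteq> 0}"
    then obtain b where "b \<in> A" "x b = 0"
      by blast
    then have "Min (x ` A) \<le> 0"
      using assms(1) by (metis Min_le finite_imageI image_eqI)
    then show "Min (x ` A) = 0"
      using 0 by linarith
  qed
qed

text \<open>The factor card A / card B is chosen so that B gains in total what A loses, namely card
  A times the minimum.\<close>

lemma sum_flip_map:
  assumes "finite U" "A \<subseteq> U" "B \<subseteq> U" "A \<inter> B = {}" "B \<noteq> {}"
  shows "sum (flip_map A B x) U = sum x U"
proof -
  let ?m = "Min (x ` A)"
  have fin: "finite A" "finite B"
    using finite_subset[OF assms(2,1)] finite_subset[OF assms(3,1)] by auto
  have eq: "flip_map A B x v = x v + ((if v \<in> A then - ?m else 0) +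
      (if v \<in> B then real (card A) / real (card B) * ?m else 0))" for v
    using assms(4) by (auto simp: flip_map_def)
  have ind: "(\<Sum>v\<in>U. if v \<in> C then c else 0) = real (card C) * c" if "C \<subseteq> U" for C and c :: real
    using that assms(1) by (simp add: sum.If_cases Int_absorb1)
  have "sum (flip_map A B x) U = sum x U + (real (card A) * (- ?m) +
      real (card B) * (real (card A) / real (card B) * ?m))"
    unfolding eq sum.distrib ind[OF assms(2)] ind[OF assms(3)] ..
  also have "\<dots> = sum x U"
    using assms(5) fin(2) by simp
  finally show ?thesis .
qed

text \<open>Away from the star of A the minimum over A vanishes and the map is the identity.\<close>

lemma flip_map_in_polyhedron:
  assumes AB: "finite A" "A \<noteq> {}" "finite B" "B \<noteq> {}" "A \<inter> B = {}"
    and KB: "\<And>F. F \<in> K \<Longrightarrow> \<not> B \<subseteq> F"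
    and KA: "\<And>F. F \<in> K \<Longrightarrow> A \<subseteq> F \<Longrightarrow> F \<subseteq> A \<union> B"
    and L: "{F \<in> K. \<not> A \<subseteq> F} \<subseteq> L" "{F. F \<subseteq> A \<union> B \<and> B \<subseteq> F \<and> \<not> A \<subseteq> F} \<subseteq> L"
    and U: "finite U" "vertices K \<subseteq> U" "vertices L \<subseteq> U" "A \<subseteq> U" "B \<subseteq> U"
    and x: "x \<in> polyhedron K"
  shows "flip_map A B x \<in> polyhedron L" "flip_map B A (flip_map A B x) = x"
proof -
  define m where "m = Min (x ` A)"
  define r where "r = real (card A) / real (card B)"
  define y where "y = flip_map A B x"
  have y: "y v = (if v \<in> A then x v - m else if v \<in> B then x v + r * m else x v)" for v
    unfolding y_def m_def r_def flip_map_def ..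
  have nn: "0 \<le> x v" and S: "{v. x v \<noteq> 0} \<in> K" and sum: "sum x U = 1" for v
    using x polyhedron_iff[OF U(1,2)] by auto
  have m: "0 \<le> m" "m = 0 \<longleftrightarrow> \<not> A \<subseteq> {v. x v \<noteq> 0}"
    unfolding m_def using Min_image_nonneg[OF AB(1,2), of x] nn by blast+
  have mle: "m \<le> x v" if "v \<in> A" for v
    unfolding m_def using that AB(1) by simp
  have "m \<in> x ` A"
    unfolding m_def using AB by (intro Min_in) auto
  then obtain a where a: "a \<in> A" "x a = m"
    by auto
  have cA: "0 < real (card A)" and cB: "0 < real (card B)"
    using AB by (simp_all add: card_gt_0_iff)
  then have r: "0 < r" "real (card B) / real (card A) * (r * m) = m"
    by (simp_all add: r_def)
  have y0: "0 \<le> y v" for v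
    using nn[of v] mle[of v] m(1) r(1) by (simp add: y)
  have B: "\<not> B \<subseteq> {v. x v \<noteq> 0}"
    using KB[OF S] .
  then obtain b where b: "b \<in> B" "x b = 0"
    by auto
  have yB: "y v = x v + r * m" if "v \<in> B" for v
    using that AB(5) by (auto simp: y)
  \<comment> \<open>Some b in B has x b = 0, so the minimum over B after the shift is exactly the
    amount that was added. The reverse map therefore subtracts this amount from B and gives m back
    to every element of A.\<close>
  have Min_y: "Min (y ` B) = r * m"
  proof (intro Min_eqI)
    show "finite (y ` B)"
      using AB(3) by simp
    show "r * m \<le> t" if "t \<in> y ` B" for t
      using that yB nn by auto
    show "r * m \<in> y ` B"
      using b yB[OF b(1)] by (metis add_0 imageI)
  qed
  have "flip_map B A y v = x v" for v
    unfolding flip_map_def Min_y r(2) y using AB(5) by auto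
  then have inv: "flip_map B A y = x"
    by blast
  have "{v. y v \<noteq> 0} \<in> L"
  proof (cases "A \<subseteq> {v. x v \<noteq> 0}")
    case False
    then have "m = 0"
      using m(2) by simp
    then have "y v = x v" for v
      by (simp add: y)
    then show ?thesis
      using False S L(1) by auto
  next
    case True
    then have mp: "0 < r * m"
      using m r by simp
    have sub: "{v. x v \<noteq> 0} \<subseteq> A \<union> B"
      using KA[OF S True] .
    have "y v \<noteq> 0" if "v \<in> B" for v
      using yB[OF that] nn[of v] mp by simp
    then have "B \<subseteq> {v. y v \<noteq> 0}"
      by blast
    \<comment> \<open>The element at which the minimum over A is attained leaves the
      support.\<close>
    moreover have "y a = 0"
      using a by (simp add: y)
    moreover have "{v. y v \<noteq> 0} \<subseteq> A \<union> B"
      using sub by (auto simp: y)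
    ultimately show ?thesis
      using a(1) L(2) by blast
  qed
  then show "flip_map A B x \<in> polyhedron L" "flip_map B A (flip_map A B x) = x"
    using y0 inv sum_flip_map[OF U(1,4,5) AB(5,4)] sum polyhedron_iff[OF U(1,3)]
    unfolding y_def by auto
qed

text \<open>\<open>KB\<close>, \<open>KA\<close> and \<open>AK\<close> together say that B is a
  missing face and that the link of A is the boundary of B. The flipped complex has the
  corresponding properties with A and B exchanged, so the reverse flip map is a continuous
  inverse.\<close>

lemma flip_homeomorphic:
  assumes "finite K" "\<And>F. F \<in> K \<Longrightarrow> finite F"
    and AB: "finite A" "A \<noteq> {}" "finite B" "B \<noteq> {}" "A \<inter> B = {}"
    and KB: "\<And>F. F \<in> K \<Longrightarrow> \<not> B \<subseteq> F"
    and KA: "\<And>F. F \<in> K \<Longrightarrow> A \<subseteq> F \<Longrightarrow> F \<subseteq> A \<union> B"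
    and AK: "\<And>F. A \<subseteq> F \<Longrightarrow> F \<subseteq> A \<union> B \<Longrightarrow> \<not> B \<subseteq> F \<Longrightarrow> F \<in> K"
  shows "polyhedron K homeomorphic polyhedron (flip A B K)"
proof -
  let ?U = "vertices K \<union> A \<union> B" and ?L = "flip A B K"
  have U: "finite ?U" "vertices K \<subseteq> ?U" "vertices ?L \<subseteq> ?U" "A \<subseteq> ?U" "B \<subseteq> ?U"
  proof -
    show "finite ?U"
      using assms(1,2) AB(1,3) by (simp add: vertices_def)
    show "vertices ?L \<subseteq> ?U"
      unfolding vertices_def flip_def by blast
  qed blast+
  have "flip_map A B x \<in> polyhedron ?L \<and> flip_map B A (flip_map A B x) = x"
    if "x \<in> polyhedron K" for x
    using flip_map_in_polyhedron[OF AB KB KA _ _ U that] unfolding flip_def by blast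
  moreover have "flip_map B A y \<in> polyhedron K \<and> flip_map A B (flip_map B A y) = y"
    if "y \<in> polyhedron ?L" for y
  proof -
    have 1: "B \<inter> A = {}" "\<And>F. F \<in> ?L \<Longrightarrow> \<not> A \<subseteq> F"
      "\<And>F. F \<in> ?L \<Longrightarrow> B \<subseteq> F \<Longrightarrow> F \<subseteq> B \<union> A"
      using AB(5) KB unfolding flip_def by blast+
    \<comment> \<open>K can serve as the target of the reverse map: it contains both families, the
      second one by \<open>AK\<close>.\<close>
    have 2: "{F \<in> ?L. \<not> B \<subseteq> F} \<subseteq> K" "{F. F \<subseteq> B \<union> A \<and> A \<subseteq> F \<and> \<not> B \<subseteq> F} \<subseteq> K"
      using AK unfolding flip_def by blast+
    show ?thesis
      using flip_map_in_polyhedron[OF AB(3,4,1,2) 1 2 U(1,3,2,5,4) that] by blast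
  qed
  ultimately show ?thesis
    unfolding homeomorphic_minimal
    using continuous_on_flip_map[OF AB(1,2)] continuous_on_flip_map[OF AB(3,4)] by blast
qed

section \<open>Self maps of even-dimensional spheres\<close>

definition reflect :: "nat \<Rightarrow> (nat \<Rightarrow> real) \<Rightarrow> nat \<Rightarrow> real" where
  "reflect k x = (\<lambda>i. if i = k then - x i else x i)"

lemma continuous_map_reflect: "continuous_map (nsphere p) (nsphere p) (reflect k)"
  unfolding reflect_def by (rule continuous_map_nsphere_reflection)

lemma continuous_map_nsphere_transpose:
  assumes "k \<le> p"
  shows "continuous_map (nsphere p) (nsphere p) (\<lambda>x i. x (Transposition.transpose 0 k i))"
proof -
  have "continuous_map (nsphere p) (powertop_real UNIV) (\<lambda>x i. x (Transposition.transpose 0 k i))"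
    unfolding continuous_map_componentwise_UNIV
    by (simp add: continuous_map_nsphere_projection)
  moreover have "(\<Sum>i\<le>p. (x (Transposition.transpose 0 k i))\<^sup>2) = (\<Sum>i\<le>p. (x i)\<^sup>2)" for x :: "nat \<Rightarrow> real"
    by (rule sum.reindex_bij_betw[where g = "\<lambda>i. (x i)\<^sup>2"])
      (use assms in \<open>auto intro!: bij_betw_byWitness[where f' = "Transposition.transpose 0 k"] simp: Transposition.transpose_def\<close>)
  moreover have "Transposition.transpose 0 k i = i" if "i > p" for i
    using that assms by (simp add: transpose_def)
  ultimately show ?thesis
    unfolding nsphere continuous_map_in_subtopology by auto
qed

text \<open>The reflection in coordinate k is the reflection in coordinate 0 conjugated by the swap
  s of the two coordinates. Since s is an involution, its degree squares to 1 and the conjugation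
  does not change the degree.\<close>

lemma Brouwer_degree2_reflect:
  assumes "k \<le> p"
  shows "Brouwer_degree2 p (reflect k) = -1"
proof -
  define s where "s = (\<lambda>x::nat \<Rightarrow> real. \<lambda>i. x (Transposition.transpose 0 k i))"
  have s: "continuous_map (nsphere p) (nsphere p) s"
    unfolding s_def by (rule continuous_map_nsphere_transpose[OF assms])
  have "s \<circ> s = id"
    by (auto simp: s_def fun_eq_iff)
  then have ss: "Brouwer_degree2 p s * Brouwer_degree2 p s = 1"
    using Brouwer_degree2_compose[OF s s] by simp
  have "reflect k = s \<circ> (reflect 0 \<circ> s)"
    by (auto simp: s_def reflect_def fun_eq_iff Transposition.transpose_def)
  then have "Brouwer_degree2 p (reflect k)
      = Brouwer_degree2 p s * (Brouwer_degree2 p (reflect 0) * Brouwer_degree2 p s)"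
    by (metis Brouwer_degree2_compose continuous_map_compose s continuous_map_reflect)
  moreover have "Brouwer_degree2 p (reflect 0) = -1"
    unfolding reflect_def by (rule Brouwer_degree2_reflection)
  ultimately show ?thesis
    using ss by simp
qed

text \<open>The map \<open>neg j\<close> negates the coordinates below j and is a composition of j
  reflections.\<close>

lemma Brouwer_degree2_antipodal:
  "Brouwer_degree2 p (\<lambda>x i. - x i) = (-1) ^ Suc p"
proof -
  define neg where "neg = (\<lambda>j (x::nat \<Rightarrow> real) i. if i < j then - x i else x i)"
  have "continuous_map (nsphere p) (nsphere p) (neg j) \<and> Brouwer_degree2 p (neg j) = (-1) ^ j"
    if "j \<le> Suc p" for j
    using that
  proof (induction j)
    case 0
    have "neg 0 = id"
      by (auto simp: neg_def)
    then show ?case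
      using Brouwer_degree2_id[of p] continuous_map_id[of "nsphere p"] by (simp only: power_0)
  next
    case (Suc j)
    have *: "neg (Suc j) = reflect j \<circ> neg j"
      by (auto simp: neg_def reflect_def fun_eq_iff)
    show ?case
      unfolding *
      using Suc Brouwer_degree2_reflect[of j p] Brouwer_degree2_compose[of p "neg j" "reflect j"]
        continuous_map_compose[OF _ continuous_map_reflect, of "nsphere p" p "neg j" j]
        continuous_map_reflect[of p j]
      by (simp del: o_apply)
  qed
  then have "Brouwer_degree2 p (neg (Suc p)) = (-1) ^ Suc p"
    by blast
  \<comment> \<open>Points of the sphere vanish beyond coordinate p, so there the negation of the
    first p + 1 coordinates agrees with the antipodal map.\<close>
  moreover have "Brouwer_degree2 p (\<lambda>x i. - x i) = Brouwer_degree2 p (neg (Suc p))"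
    by (rule Brouwer_degree2_eq) (auto simp: nsphere neg_def fun_eq_iff)
  ultimately show ?thesis
    by simp
qed

text \<open>The segment from f(x) to -x misses the origin unless f(x) = x.\<close>

lemma homotopic_antipodal:
  assumes f: "continuous_map (nsphere p) (nsphere p) f"
    and nofix: "\<And>x. x \<in> topspace (nsphere p) \<Longrightarrow> f x \<noteq> x"
  shows "homotopic_with (\<lambda>x. True) (nsphere p) (nsphere p) f (\<lambda>x i. - x i)"
proof -
  let ?X = "prod_topology (top_of_set {0..1::real}) (nsphere p)"
  define h where "h = (\<lambda>(t, x) i. (1 - t) * f x i - t * x i)"
  define N where "N = (\<lambda>z. sqrt (\<Sum>j\<le>p. (h z j)\<^sup>2))"
  have fx: "(\<Sum>j\<le>p. (f x j)\<^sup>2) = 1" "\<And>i. i > p \<Longrightarrow> f x i = 0"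
    if "x \<in> topspace (nsphere p)" for x
    using continuous_map_image_subset_topspace[OF f] that by (auto simp: nsphere)
  have x1: "(\<Sum>j\<le>p. (x j)\<^sup>2) = 1" "\<And>i. i > p \<Longrightarrow> x i = 0"
    if "x \<in> topspace (nsphere p)" for x
    using that by (auto simp: nsphere)
  have N0: "N (t, x) \<noteq> 0" if x: "x \<in> topspace (nsphere p)" and t: "0 \<le> t" "t \<le> 1" for t x
  proof
    assume "N (t, x) = 0"
    then have "(h (t, x) j)\<^sup>2 = 0" if "j \<le> p" for j
      using that by (simp add: N_def sum_nonneg_eq_0_iff)
    then have e: "(1 - t) * f x j = t * x j" if "j \<le> p" for j
      using that by (simp add: h_def)
    \<comment> \<open>Both f x and x have norm 1, so comparing the norms of the two sides forces t =
      1/2.\<close>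
    have "(1 - t)\<^sup>2 * (\<Sum>j\<le>p. (f x j)\<^sup>2) = t\<^sup>2 * (\<Sum>j\<le>p. (x j)\<^sup>2)"
      unfolding sum_distrib_left power_mult_distrib[symmetric] using e by simp
    then have t2: "1 - t = t"
      using fx(1)[OF x] x1(1)[OF x] t by (simp add: power2_eq_iff_nonneg)
    then have "t \<noteq> 0"
      by auto
    moreover have "t * f x j = t * x j" if "j \<le> p" for j
      using e[OF that] unfolding t2 .
    ultimately have "f x j = x j" for j
      using fx(2)[OF x, of j] x1(2)[OF x, of j] by (cases "j \<le> p") auto
    then show False
      using nofix[OF x] by blast
  qed
  have ch: "continuous_map ?X euclideanreal (\<lambda>z. h z i)" for i
  proof -
    have "continuous_map ?X (nsphere p) (f \<circ> snd)"
      using f continuous_map_compose continuous_map_snd by blast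
    then have 1: "continuous_map ?X euclideanreal (\<lambda>z. f (snd z) i)"
      using continuous_map_compose[OF _ continuous_map_nsphere_projection] by (auto simp: o_def)
    have 2: "continuous_map ?X euclideanreal (\<lambda>z. snd z i)"
      using continuous_map_compose[OF continuous_map_snd continuous_map_nsphere_projection]
      by (auto simp: o_def)
    have 3: "continuous_map ?X euclideanreal fst"
      by (rule continuous_map_into_fulltopology[OF continuous_map_fst])
    show ?thesis
      unfolding h_def case_prod_unfold by (intro continuous_intros 1 2 3)
  qed
  have "continuous_map ?X euclideanreal (\<lambda>z. h z i / N z)" for i
    unfolding N_def
    by (intro continuous_intros ch) (use N0 in \<open>auto simp: N_def\<close>)
  moreover have "(\<Sum>i\<le>p. (h z i / N z)\<^sup>2) = 1" if "z \<in> topspace ?X" for z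
  proof -
    have "N z \<noteq> 0"
      using that N0 by (cases z) auto
    moreover have "(N z)\<^sup>2 = (\<Sum>j\<le>p. (h z j)\<^sup>2)"
      by (simp add: N_def sum_nonneg)
    ultimately show ?thesis
      unfolding power_divide sum_divide_distrib[symmetric] by (metis divide_self power_not_zero)
  qed
  moreover have "h z i / N z = 0" if "z \<in> topspace ?X" "i > p" for z i
    using that fx(2) x1(2) by (auto simp: h_def)
  ultimately have "continuous_map ?X (nsphere p) (\<lambda>z i. h z i / N z)"
    by (auto simp: nsphere continuous_map_in_subtopology continuous_map_componentwise_UNIV)
  moreover have "(\<lambda>i. h (0, x) i / N (0, x)) = f x" "(\<lambda>i. h (1, x) i / N (1, x)) = (\<lambda>i. - x i)"
    if "x \<in> topspace (nsphere p)" for x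
    using fx(1)[OF that] x1(1)[OF that] by (simp_all add: h_def N_def)
  ultimately show ?thesis
    by (subst homotopic_with) (blast, force)
qed

text \<open>Transported to the sphere, T becomes a map f, and f \<circ> f has degree (deg f)^2 \<ge>
  0. Without a fixed point it would be homotopic to the antipodal map, whose degree is -1.\<close>

lemma even_sphere_square_has_fixpoint:
  assumes "even d" and X: "X homeomorphic_space nsphere d" and T: "continuous_map X X T"
  obtains x where "x \<in> topspace X" "T (T x) = x"
proof -
  obtain h k where hk: "homeomorphic_maps X (nsphere d) h k"
    using X unfolding homeomorphic_space_def by blast
  then have h: "continuous_map X (nsphere d) h" and k: "continuous_map (nsphere d) X k"
    and kh: "\<And>x. x \<in> topspace X \<Longrightarrow> k (h x) = x"
    unfolding homeomorphic_maps_def by auto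
  define f where "f = h \<circ> (T \<circ> k)"
  have f: "continuous_map (nsphere d) (nsphere d) f"
    unfolding f_def by (intro continuous_map_compose[OF _ h] continuous_map_compose[OF k T])
  have "Brouwer_degree2 d (f \<circ> f) = Brouwer_degree2 d f * Brouwer_degree2 d f"
    by (rule Brouwer_degree2_compose[OF f f])
  then have "Brouwer_degree2 d (f \<circ> f) \<noteq> -1"
    by (smt (verit) zero_le_square)
  moreover have "(-1::int) ^ Suc d = -1"
    using \<open>even d\<close> by simp
  ultimately have "\<not> homotopic_with (\<lambda>x. True) (nsphere d) (nsphere d) (f \<circ> f) (\<lambda>x i. - x i)"
    using Brouwer_degree2_homotopic Brouwer_degree2_antipodal[of d] by metis
  then obtain y where y: "y \<in> topspace (nsphere d)" "f (f y) = y"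
    using homotopic_antipodal[of d "f \<circ> f"] continuous_map_compose[OF f f] by auto
  have ky: "k y \<in> topspace X" and Tky: "T (k y) \<in> topspace X" "T (T (k y)) \<in> topspace X"
    using y(1) continuous_map_image_subset_topspace[OF k] continuous_map_image_subset_topspace[OF T]
    by blast+
  have "k (f (f y)) = T (T (k y))"
    by (simp add: f_def kh Tky)
  then show thesis
    using that[OF ky] y(2) by simp
qed

section \<open>Cyclic symmetry of even-dimensional spheres\<close>

text \<open>The automorphism permutes barycentric coordinates; the support of a point fixed by the
  square of this action is an invariant face.\<close>

lemma automorphism_square_fixes_face:
  assumes "even d" and K: "simplicial_sphere d K" and g: "complex_automorphism K g"
  obtains F where "F \<in> K" "F \<noteq> {}" "(g \<circ> g) ` F = F"
proof -
  let ?V = "vertices K"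
  have K1: "finite K" "\<And>F. F \<in> K \<Longrightarrow> finite F" "geometric_realization K homeomorphic_space nsphere d"
    using K unfolding simplicial_sphere_def abstract_complex_def by auto
  have bij: "bij_betw g ?V ?V" and gK: "(`) g ` K = K"
    using g unfolding complex_automorphism_def by auto
  have V: "\<And>F. F \<in> K \<Longrightarrow> F \<subseteq> ?V"
    unfolding vertices_def by auto
  \<comment> \<open>Composition with g moves supports by the inverse of g. Coordinates off the
    vertices are set to 0 because nothing is known of g there.\<close>
  define T where "T = (\<lambda>(x::'a \<Rightarrow> real) v. if v \<in> ?V then x (g v) else 0)"
  have T: "T x \<in> polyhedron K" if x: "x \<in> polyhedron K" for x
  proof -
    have x': "\<forall>v. 0 \<le> x v" "{v. x v \<noteq> 0} \<in> K" "sum x ?V = 1"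
      using x unfolding polyhedron_def by auto
    obtain F where F: "F \<in> K" "g ` F = {v. x v \<noteq> 0}"
      using x'(2) gK by (metis imageE)
    have "{v. T x v \<noteq> 0} = {v \<in> ?V. g v \<in> g ` F}"
      unfolding F(2) T_def by auto
    also have "\<dots> = F"
      using V[OF F(1)] bij by (auto simp: bij_betw_def dest: inj_onD)
    finally have "{v. T x v \<noteq> 0} \<in> K"
      using F(1) by simp
    moreover have "sum (T x) ?V = sum (\<lambda>v. x (g v)) ?V"
      unfolding T_def by (rule sum.cong) auto
    then have "sum (T x) ?V = 1"
      using sum.reindex_bij_betw[OF bij, of x] x'(3) by simp
    ultimately show ?thesis
      using x'(1) unfolding polyhedron_def T_def by auto
  qed
  have "continuous_on (polyhedron K) T"
  proof (rule continuous_on_coordinatewise_then_product)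
    show "continuous_on (polyhedron K) (\<lambda>x. T x v)" for v
      unfolding T_def by (cases "v \<in> ?V") (simp_all add: continuous_on_coordinate)
  qed
  then have "continuous_map (geometric_realization K) (geometric_realization K) T"
    unfolding geometric_realization_polyhedron using T by auto
  then obtain x where x: "x \<in> polyhedron K" "T (T x) = x"
    using even_sphere_square_has_fixpoint[OF assms(1) K1(3)]
    unfolding geometric_realization_polyhedron by auto
  define F where "F = {v. x v \<noteq> 0}"
  have F: "F \<in> K" "sum x ?V = 1"
    using x(1) unfolding polyhedron_def F_def by auto
  have gV: "g v \<in> ?V" if "v \<in> ?V" for v
    using that bij by (auto simp: bij_betw_def)
  have "(g \<circ> g) ` F \<subseteq> F"
  proof
    fix w assume "w \<in> (g \<circ> g) ` F"
    then obtain v where v: "v \<in> F" "w = g (g v)"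
      by auto
    then have "v \<in> ?V"
      using V[OF F(1)] by auto
    then have "x v = x (g (g v))"
      using fun_cong[OF x(2), of v] gV by (simp add: T_def)
    then show "w \<in> F"
      using v by (simp add: F_def)
  qed
  moreover have "inj_on (g \<circ> g) F"
    using bij V[OF F(1)] gV unfolding bij_betw_def
    by (intro comp_inj_on) (auto intro: inj_on_subset)
  ultimately have "(g \<circ> g) ` F = F"
    using K1(2)[OF F(1)] by (metis card_image card_subset_eq)
  moreover have "F \<noteq> {}"
    using F(2) unfolding F_def by (metis (mono_tags, lifting) empty_Collect_eq sum.neutral zero_neq_one)
  ultimately show thesis
    using that F(1) by blast
qed

text \<open>An open simplex on \<open>Suc CARD('n)\<close> vertices of F embeds into the realization
  and hence into the euclidean space of dimension d + 1 around the sphere; invariance of domain then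
  compares dimensions. Types carry the two numbers because they index the euclidean spaces. Working
  in the ambient space yields at most d + 2 vertices for a face, one more than the true
  bound.\<close>

lemma simplicial_sphere_face_bound:
  fixes K :: "'a set set"
  assumes K: "simplicial_sphere d K" and d: "Suc d = CARD('m::finite)"
    and F: "F \<in> K" "Suc CARD('n::finite) \<le> card F"
  shows "CARD('n) \<le> CARD('m)"
proof -
  have K1: "finite K" "\<And>F. F \<in> K \<Longrightarrow> finite F" "\<And>F G. F \<in> K \<Longrightarrow> G \<subseteq> F \<Longrightarrow> G \<in> K"
      "geometric_realization K homeomorphic_space nsphere d"
    using K unfolding simplicial_sphere_def abstract_complex_def by auto
  obtain G where G: "G \<subseteq> F" "card G = Suc CARD('n)"
    using F(2) obtain_subset_with_card_n by metis
  have GK: "G \<in> K" "finite G"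
    using K1(2,3) F(1) G(1) by blast+
  obtain v0 where v0: "v0 \<in> G"
    using G(2) by fastforce
  have "card (UNIV :: 'n set) = card (G - {v0})"
    using G(2) GK(2) v0 by simp
  then obtain e :: "'n \<Rightarrow> 'a" where e: "bij_betw e UNIV (G - {v0})"
    using GK(2) by (metis finite_Diff finite_same_card_bij finite_class.finite_UNIV)
  define e' where "e' = inv_into UNIV e"
  have e': "e' (e i) = i" "v \<in> G - {v0} \<Longrightarrow> e (e' v) = v" for i v
    using e unfolding e'_def bij_betw_def by (simp_all add: f_inv_into_f)
  have ei: "e i \<in> G" "e i \<noteq> v0" for i
    using e by (auto simp: bij_betw_def)
  \<comment> \<open>The coordinate of \<open>v0\<close> is left out and recovered as 1 minus the
    others, which turns the open simplex into an open set S of full dimension.\<close>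
  define S where "S = {y :: real^'n. (\<forall>i. 0 < y $ i) \<and> (\<Sum>i\<in>UNIV. y $ i) < 1}"
  define b where "b = (\<lambda>(y::real^'n) v. if v = v0 then 1 - (\<Sum>i\<in>UNIV. y $ i)
      else if v \<in> G then y $ e' v else 0)"
  have "S = (\<Inter>i. {y. 0 < y $ i}) \<inter> {y. (\<Sum>i\<in>UNIV. y $ i) < 1}"
    by (auto simp: S_def)
  then have "open S"
    by (auto intro!: open_INT open_Int open_Collect_less continuous_intros)
  have "(\<chi> i. 1 / (real CARD('n) + 1)) \<in> S"
    unfolding S_def by (simp add: field_simps)
  then have "S \<noteq> {}"
    by blast
  have b: "b y \<in> polyhedron K" if y: "y \<in> S" for y
  proof -
    have "{v. b y v \<noteq> 0} \<subseteq> G"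
      using v0 by (auto simp: b_def)
    then have "{v. b y v \<noteq> 0} \<in> K"
      using K1(3) GK(1) by blast
    moreover have "sum (b y) (G - {v0}) = (\<Sum>i\<in>UNIV. b y (e i))"
      by (rule sum.reindex_bij_betw[OF e, symmetric])
    then have "sum (b y) G = 1"
      using v0 GK(2) ei e' by (simp add: sum.remove b_def)
    moreover have "sum (b y) (vertices K) = sum (b y) G"
      using GK K1 \<open>{v. b y v \<noteq> 0} \<subseteq> G\<close>
      by (intro sum.mono_neutral_right) (auto simp: vertices_def)
    moreover have "0 \<le> b y v" for v
      using y by (auto simp: b_def S_def less_imp_le)
    ultimately show ?thesis
      unfolding polyhedron_def by simp
  qed
  have cb: "continuous_on S b"
  proof (rule continuous_on_coordinatewise_then_product)
    show "continuous_on S (\<lambda>y. b y v)" for v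
      unfolding b_def by (cases "v = v0"; cases "v \<in> G") (auto intro!: continuous_intros)
  qed
  obtain h k where hk: "homeomorphic_maps (geometric_realization K) (nsphere d) h k"
    using K1(4) unfolding homeomorphic_space_def by blast
  have "continuous_map (geometric_realization K) (nsphere d) h"
    using hk unfolding homeomorphic_maps_def by auto
  then have h: "continuous_map (top_of_set (polyhedron K)) euclidean h"
      "\<And>x i. x \<in> polyhedron K \<Longrightarrow> d < i \<Longrightarrow> h x i = 0"
    unfolding nsphere continuous_map_in_subtopology geometric_realization_polyhedron
    by (auto simp: euclidean_product_topology)
  have inj_h: "inj_on h (polyhedron K)"
    using hk unfolding homeomorphic_maps_def geometric_realization_polyhedron
    by (metis inj_on_inverseI topspace_euclidean_subtopology)
  \<comment> \<open>Only the coordinates 0, ..., d can be nonzero on the sphere. They are numbered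
    by the type \<open>'m\<close>, and restricting to them loses no injectivity.\<close>
  obtain u :: "'m \<Rightarrow> nat" where u: "bij_betw u UNIV {..<Suc d}"
    using d by (metis card_lessThan finite_class.finite_UNIV finite_lessThan finite_same_card_bij)
  define f where "f = (\<lambda>y. \<chi> i. h (b y) (u i))"
  have "continuous_on S (h \<circ> b)"
    using h(1) b by (intro continuous_on_compose cb) (auto intro: continuous_on_subset)
  then have "continuous_on S (\<lambda>y. h (b y) j)" for j
    using continuous_on_product_then_coordinatewise[of S "h \<circ> b" j] by simp
  then have "continuous_on S f"
    unfolding f_def by (intro continuous_on_vec_lambda)
  moreover have "inj_on f S"
  proof
    fix y z assume y: "y \<in> S" and z: "z \<in> S" and eq: "f y = f z"
    have "h (b y) j = h (b z) j" for j
    proof (cases "j \<le> d")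
      case True
      then obtain i where "j = u i"
        using u by (metis bij_betw_imp_surj_on imageE lessThan_iff less_Suc_eq_le)
      then show ?thesis
        using eq by (simp add: f_def vec_eq_iff)
    next
      case False
      then show ?thesis
        using h(2) b y z by simp
    qed
    then have "b y = b z"
      using inj_h b y z by (meson ext inj_onD)
    moreover have "b y (e i) = y $ i" for y i
      using ei[of i] e'(1)[of i] by (simp add: b_def)
    ultimately have "y $ i = z $ i" for i
      by metis
    then show "y = z"
      by (simp add: vec_eq_iff)
  qed
  ultimately have "DIM(real^'n) \<le> DIM(real^'m)"
    using invariance_of_dimension[of S f] \<open>open S\<close> \<open>S \<noteq> {}\<close> by blast
  then show ?thesis
    by simp
qed

text \<open>Powers of the cycle rotate the list of labels. Labels start at 1 and residues at 0,
  hence the shifts by 1.\<close>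

lemma std_cycle_funpow:
  assumes "i \<in> {1..n}"
  shows "(std_cycle n ^^ m) i = (i - 1 + m) mod n + 1"
proof -
  have nth: "[1..<n + 1] ! j = j + 1" if "j < n" for j
    using that by (simp del: upt_Suc)
  have "map (cycle_of_list [1..<n + 1] ^^ m) [1..<n + 1] = rotate m [1..<n + 1]"
    by (rule cyclic_rotation) simp
  then have "map (std_cycle n ^^ m) [1..<n + 1] ! (i - 1) = rotate m [1..<n + 1] ! (i - 1)"
    by (simp only: std_cycle_def)
  moreover have "map (std_cycle n ^^ m) [1..<n + 1] ! (i - 1) = (std_cycle n ^^ m) ([1..<n + 1] ! (i - 1))"
    by (intro nth_map) (use assms in \<open>auto simp del: upt_Suc\<close>)
  moreover have "rotate m [1..<n + 1] ! (i - 1) = [1..<n + 1] ! ((i - 1 + m) mod n)"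
    using assms nth_rotate[of "i - 1" "[1..<n + 1]" m] by (auto simp: add.commute simp del: upt_Suc)
  moreover have "i - 1 < n" "(i - 1 + m) mod n < n" "i - 1 + 1 = i"
    using assms by auto
  ultimately show ?thesis
    using nth by metis
qed

lemma std_cycle_funpow_in: "i \<in> {1..n} \<Longrightarrow> (std_cycle n ^^ m) i \<in> {1..n}"
  by (simp add: std_cycle_funpow Suc_le_eq)

text \<open>The cycle acts on labels only; conjugating it by \<open>lab\<close> gives an
  automorphism of K itself, whose invariant face is then read in the labels again.\<close>

lemma cyclic_even_sphere_fixed_face:
  assumes "even d" and K: "simplicial_sphere d K" and n: "card (vertices K) = n"
    and lab: "bij_betw lab (vertices K) {1..n}"
    and aut: "complex_automorphism ((`) lab ` K) (std_cycle n)"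
  obtains F where "F \<in> K" "F \<noteq> {}" "(std_cycle n ^^ 2) ` lab ` F = lab ` F"
proof -
  let ?V = "vertices K" and ?c = "std_cycle n"
  define l where "l = inv_into ?V lab"
  define g where "g = l \<circ> ?c \<circ> lab"
  have l: "bij_betw l {1..n} ?V"
    unfolding l_def by (rule bij_betw_inv_into[OF lab])
  have ll: "l (lab v) = v" if "v \<in> ?V" for v
    using that lab unfolding l_def by (simp add: bij_betw_def inv_into_f_f)
  have ll': "lab (l i) = i" if "i \<in> {1..n}" for i
    using that lab unfolding l_def by (metis bij_betw_inv_into_right)
  have V: "F \<subseteq> ?V" if "F \<in> K" for F
    using that by (auto simp: vertices_def)
  have labV: "lab v \<in> {1..n}" if "v \<in> ?V" for v
    using bij_betwE[OF lab] that by blast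
  have lV: "l ` lab ` F = F" if "F \<in> K" for F
    using V[OF that] ll by (force simp: image_iff)
  have "vertices ((`) lab ` K) = lab ` ?V"
    unfolding vertices_def by blast
  then have "vertices ((`) lab ` K) = {1..n}"
    using lab by (simp add: bij_betw_def)
  then have c: "bij_betw ?c {1..n} {1..n}" "(`) ?c ` (`) lab ` K = (`) lab ` K"
    using aut unfolding complex_automorphism_def by auto
  have "bij_betw g ?V ?V"
    unfolding g_def using lab c(1) l by (blast intro: bij_betw_trans)
  moreover have "(`) g ` K = (`) l ` (`) ?c ` (`) lab ` K"
    by (simp add: g_def image_comp comp_def)
  then have "(`) g ` K = K"
    unfolding c(2) using lV by (simp add: image_comp)
  ultimately have "complex_automorphism K g"
    unfolding complex_automorphism_def by blast
  then obtain F where F: "F \<in> K" "F \<noteq> {}" "(g \<circ> g) ` F = F"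
    using automorphism_square_fixes_face[OF assms(1) K] by blast
  have "lab (g v) = ?c (lab v)" if "v \<in> ?V" for v
    using ll'[of "?c (lab v)"] std_cycle_funpow_in[OF labV[OF that], of 1] by (simp add: g_def)
  moreover have "g v \<in> ?V" if "v \<in> ?V" for v
    using that \<open>bij_betw g ?V ?V\<close> by (auto simp: bij_betw_def)
  ultimately have "lab ((g \<circ> g) v) = (?c ^^ 2) (lab v)" if "v \<in> F" for v
    using that V[OF F(1)] by (auto simp: numeral_2_eq_2)
  then have "(?c ^^ 2) ` lab ` F = lab ` (g \<circ> g) ` F"
    unfolding image_image by (intro image_cong) auto
  then show thesis
    using that F by metis
qed

section \<open>Exclusion of the pairs (4,12), (6,16) and (4,14)\<close>

lemma no_cyclic_cs_sphere_4_dvd: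
  assumes "even d" and K: "simplicial_sphere d K" and I: "central_symmetry K I"
    and c: "cyclic_vertex_transitive K I" and n: "4 dvd card (vertices K)"
  shows False
proof -
  define n where "n = card (vertices K)"
  obtain lab where lab: "bij_betw lab (vertices K) {1..n}"
      "complex_automorphism ((`) lab ` K) (std_cycle n)"
      "\<And>v. v \<in> vertices K \<Longrightarrow> lab (I v) = (std_cycle n ^^ (n div 2)) (lab v)"
    using c unfolding cyclic_vertex_transitive_def n_def Let_def by blast
  obtain F where F: "F \<in> K" "F \<noteq> {}" "(std_cycle n ^^ 2) ` lab ` F = lab ` F"
    using cyclic_even_sphere_fixed_face[OF assms(1) K _ lab(1,2)] n_def by blast
  have FV: "F \<subseteq> vertices K"
    using F(1) by (auto simp: vertices_def)
  have "((std_cycle n ^^ 2) ^^ m) ` lab ` F = lab ` F" for m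
  proof (induction m)
    case (Suc m)
    have "((std_cycle n ^^ 2) ^^ Suc m) ` lab ` F = ((std_cycle n ^^ 2) ^^ m) ` (std_cycle n ^^ 2) ` lab ` F"
      unfolding funpow_Suc_right image_comp comp_assoc ..
    then show ?case
      unfolding F(3) Suc .
  qed simp
  \<comment> \<open>Here n div 2 = 2 * (n div 4), because 4 divides n.\<close>
  moreover have "std_cycle n ^^ (n div 2) = (std_cycle n ^^ 2) ^^ (n div 4)"
    using n by (auto simp: n_def funpow_mult elim!: dvdE)
  ultimately have "(std_cycle n ^^ (n div 2)) ` lab ` F = lab ` F"
    by simp
  moreover have "lab ` I ` F = (std_cycle n ^^ (n div 2)) ` lab ` F"
    unfolding image_image using lab(3) FV by (intro image_cong) auto
  ultimately have "lab ` I ` F = lab ` F"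
    by simp
  moreover have "bij_betw I (vertices K) (vertices K)"
    using I unfolding central_symmetry_def complex_automorphism_def by simp
  then have "I ` F \<subseteq> vertices K"
    using image_mono[OF FV, of I] by (simp add: bij_betw_imp_surj_on)
  ultimately have "I ` F = F"
    using lab(1) FV by (metis bij_betw_imp_inj_on inj_on_image_eq_iff)
  then show False
    using I F(1,2) unfolding central_symmetry_def by blast
qed

lemma no_cyclic_sphere_4_14:
  assumes K: "simplicial_sphere 4 K" and c: "cyclic_vertex_transitive K I"
    and n: "card (vertices K) = 14"
  shows False
proof -
  let ?c = "std_cycle 14"
  obtain lab where lab: "bij_betw lab (vertices K) {1..14}"
      "complex_automorphism ((`) lab ` K) ?c"
    using c unfolding cyclic_vertex_transitive_def n Let_def by blast
  obtain F where F: "F \<in> K" "F \<noteq> {}" "(?c ^^ 2) ` lab ` F = lab ` F"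
    using cyclic_even_sphere_fixed_face[OF _ K n lab] by auto
  have FV: "F \<subseteq> vertices K" "finite F"
    using F(1) K by (auto simp: vertices_def simplicial_sphere_def abstract_complex_def)
  obtain v where v: "v \<in> F"
    using F(2) by blast
  define i where "i = lab v"
  have i: "i \<in> {1..14}"
    unfolding i_def using bij_betwE[OF lab(1)] v FV(1) by blast
  have "((?c ^^ 2) ^^ m) i \<in> lab ` F" for m
  proof (induction m)
    case (Suc m)
    then have "(?c ^^ 2) (((?c ^^ 2) ^^ m) i) \<in> (?c ^^ 2) ` lab ` F"
      by (rule imageI)
    then show ?case
      unfolding F(3) by simp
  qed (use v in \<open>simp add: i_def\<close>)
  then have "(\<lambda>m. (i - 1 + 2 * m) mod 14 + 1) ` {..<7} \<subseteq> lab ` F"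
    by (simp add: funpow_mult std_cycle_funpow[OF i] image_subset_iff)
  moreover have "inj_on (\<lambda>m. (i - 1 + 2 * m) mod 14 + 1) {..<7}"
  proof (rule linorder_inj_onI')
    fix a b :: nat
    assume "a \<in> {..<7}" "b \<in> {..<7}" "a < b"
    \<comment> \<open>The two exponents differ by less than 7, so the shifts differ by a positive
      number below 14.\<close>
    then have "\<not> 14 dvd (i - 1 + 2 * b) - (i - 1 + 2 * a)"
      by (intro nat_dvd_not_less) auto
    then have "(i - 1 + 2 * b) mod 14 \<noteq> (i - 1 + 2 * a) mod 14"
      using \<open>a < b\<close> by (subst mod_eq_dvd_iff_nat) auto
    then show "(i - 1 + 2 * a) mod 14 + 1 \<noteq> (i - 1 + 2 * b) mod 14 + 1"
      by simp
  qed
  ultimately have "7 \<le> card (lab ` F)"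
    using FV(2) by (metis card_image card_lessThan card_mono finite_imageI)
  \<comment> \<open>Seven vertices span an open simplex of dimension 6, while the 4-sphere lives in
    dimension 5.\<close>
  then have "Suc CARD(6) \<le> card F"
    using card_image_le[OF FV(2), of lab] by simp
  then have "CARD(6) \<le> CARD(5)"
    using simplicial_sphere_face_bound[OF K _ F(1), where 'm = 5 and 'n = 6] by simp
  then show False
    by simp
qed

section \<open>Shellings\<close>

text \<open>Modulo the diagonal, the space of dimension d + 2 becomes one of dimension d + 1. Points
  of the simplex boundary and unit vectors both represent the rays of this quotient: the former are
  normalised by minimum 0 and sum 1, the latter by last coordinate 0 and norm 1. The homeomorphism
  passes between these normal forms.\<close>

lemma simplex_boundary_homeomorphic_sphere:
  assumes V: "finite V" "card V = d + 2"
  shows "geometric_realization {G. G \<subset> V} homeomorphic_space nsphere d"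
proof -
  let ?P = "polyhedron {G. G \<subset> V}"
  let ?S = "{x::nat \<Rightarrow> real. (\<Sum>i\<le>d. (x i)\<^sup>2) = 1 \<and> (\<forall>i>d. x i = 0)}"
  let ?I = "{..Suc d}"
  have nsph: "nsphere d = top_of_set ?S"
    unfolding nsphere by (simp add: euclidean_product_topology)
  obtain e where e: "bij_betw e ?I V"
    using V finite_same_card_bij[of ?I V] by auto
  define e' where "e' = inv_into ?I e"
  have e'e: "e' (e i) = i" if "i \<in> ?I" for i
    using that e unfolding e'_def by (metis bij_betw_inv_into_left)
  have ee': "e (e' v) = v" "e' v \<in> ?I" if "v \<in> V" for v
    using that e unfolding e'_def by (metis bij_betw_inv_into_right, metis bij_betw_imp_surj_on inv_into_into)
  have eV: "e i \<in> V" if "i \<in> ?I" for i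
    using that bij_betwE[OF e] by blast
  have P: "x \<in> ?P \<longleftrightarrow> (\<forall>v. 0 \<le> x v) \<and> {v. x v \<noteq> 0} \<subset> V \<and> (\<Sum>i\<in>?I. x (e i)) = 1" for x
  proof -
    have "vertices {G. G \<subset> V} \<subseteq> V"
      by (auto simp: vertices_def)
    from polyhedron_iff[OF V(1) this] show ?thesis
      unfolding sum.reindex_bij_betw[OF e] by simp
  qed
  have P1: "0 \<le> x v" and P2: "{v. x v \<noteq> 0} \<subset> V" and P3: "(\<Sum>i\<in>?I. x (e i)) = 1"
    if "x \<in> ?P" for x v
    using iffD1[OF P that] by simp_all
  \<comment> \<open>The map p subtracts the last coordinate and divides by the norm N; its inverse q
    subtracts the minimum m and divides by the sum s.\<close>
  define N where "N = (\<lambda>x. sqrt (\<Sum>i\<le>d. (x (e i) - x (e (Suc d)))\<^sup>2))"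
  define p where "p = (\<lambda>x i. if i \<le> d then (x (e i) - x (e (Suc d))) / N x else 0)"
  define m where "m = (\<lambda>y::nat \<Rightarrow> real. Min (y ` ?I))"
  define s where "s = (\<lambda>y. \<Sum>i\<in>?I. y i - m y)"
  define q where "q = (\<lambda>y v. if v \<in> V then (y (e' v) - m y) / s y else 0)"
  have zero: "\<exists>i\<in>?I. x (e i) = 0" if x: "x \<in> ?P" for x
  proof -
    obtain v where "v \<in> V" "x v = 0"
      using P2[OF x] by blast
    then show ?thesis
      using ee'[of v] by (intro bexI[of _ "e' v"]) auto
  qed
  have N: "0 < N x" if x: "x \<in> ?P" for x
  proof (rule ccontr)
    assume "\<not> 0 < N x"
    then have "(\<Sum>i\<le>d. (x (e i) - x (e (Suc d)))\<^sup>2) = 0"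
      unfolding N_def using real_sqrt_gt_0_iff sum_nonneg[of "{..d}" "\<lambda>i. (x (e i) - x (e (Suc d)))\<^sup>2"]
      by fastforce
    then have "x (e i) = x (e (Suc d))" if "i \<in> ?I" for i
      using that by (cases "i = Suc d") (auto simp: sum_nonneg_eq_0_iff)
    then have "x (e i) = 0" if "i \<in> ?I" for i
      using zero[OF x] that by metis
    then show False
      using P3[OF x] by simp
  qed
  have m: "m y \<le> y i" if "i \<in> ?I" for y i
    unfolding m_def using that by (intro Min_le) auto
  have m_in: "\<exists>i\<in>?I. y i = m y" for y
  proof -
    have "Min (y ` ?I) \<in> y ` ?I"
      by (rule Min_in) auto
    then show ?thesis
      unfolding m_def by force
  qed
  have s: "0 < s y" if y: "y \<in> ?S" for y
  proof (rule ccontr)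
    assume "\<not> 0 < s y"
    then have "s y = 0"
      unfolding s_def using m sum_nonneg[of ?I "\<lambda>i. y i - m y"] by force
    then have "y i = m y" if "i \<in> ?I" for i
      using that m unfolding s_def by (subst (asm) sum_nonneg_eq_0_iff) auto
    \<comment> \<open>All coordinates equal the minimum and hence coordinate d + 1, which is 0 on
      the sphere.\<close>
    then have "y i = 0" if "i \<le> d" for i
      using that y by (metis (mono_tags, lifting) atMost_iff le_SucI lessI mem_Collect_eq order_refl)
    then show False
      using y by simp
  qed
  have pP: "p x \<in> ?S" "q (p x) = x" if x: "x \<in> ?P" for x
  proof -
    have N2: "(\<Sum>i\<le>d. (x (e i) - x (e (Suc d)))\<^sup>2) = (N x)\<^sup>2"
      unfolding N_def by (simp add: sum_nonneg)
    have "(\<Sum>i\<le>d. (p x i)\<^sup>2) = (\<Sum>i\<le>d. (x (e i) - x (e (Suc d)))\<^sup>2) / (N x)\<^sup>2"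
      unfolding sum_divide_distrib by (rule sum.cong) (auto simp: p_def power_divide)
    then show "p x \<in> ?S"
      using N[OF x] by (simp add: N2 p_def)
    have px: "p x i = (x (e i) - x (e (Suc d))) / N x" if "i \<in> ?I" for i
      using that by (auto simp: p_def le_Suc_eq)
    note x0 = P1[OF x]
    obtain j where j: "j \<in> ?I" "x (e j) = 0"
      using zero[OF x] by blast
    \<comment> \<open>The minimum is attained at the index j where x vanishes.\<close>
    have mp: "m (p x) = - x (e (Suc d)) / N x"
      unfolding m_def
    proof (rule Min_eqI)
      show "- x (e (Suc d)) / N x \<le> t" if "t \<in> p x ` ?I" for t
      proof -
        obtain i where i: "i \<in> ?I" "t = p x i"
          using \<open>t \<in> p x ` ?I\<close> by (rule imageE)
        show ?thesis
          unfolding i(2) px[OF i(1)] using x0 N[OF x] by (intro divide_right_mono) auto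
      qed
      show "- x (e (Suc d)) / N x \<in> p x ` ?I"
        using j px[OF j(1)] by (intro image_eqI[of _ _ j]) auto
    qed simp
    have pm: "p x i - m (p x) = x (e i) / N x" if "i \<in> ?I" for i
      unfolding mp px[OF that] by (simp add: diff_divide_distrib)
    have "s (p x) = (\<Sum>i\<in>?I. x (e i) / N x)"
      unfolding s_def by (rule sum.cong) (simp_all only: pm)
    also have "\<dots> = 1 / N x"
      unfolding sum_divide_distrib[symmetric] P3[OF x] ..
    finally have sp: "s (p x) = 1 / N x" .
    show "q (p x) = x"
    proof
      fix v
      show "q (p x) v = x v"
      proof (cases "v \<in> V")
        case True
        then show ?thesis
          unfolding q_def using pm[OF ee'(2)[OF True]] ee'(1)[OF True] N[OF x] by (simp add: sp)
      next
        case False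
        then have "x v = 0"
          using P2[OF x] by blast
        then show ?thesis
          using False by (simp add: q_def)
      qed
    qed
  qed
  have qS: "q y \<in> ?P" "p (q y) = y" if y: "y \<in> ?S" for y
  proof -
    have qe: "q y (e i) = (y i - m y) / s y" if "i \<in> ?I" for i
      using eV[OF that] e'e[OF that] by (simp add: q_def)
    have "0 \<le> q y v" for v
    proof (cases "v \<in> V")
      case True
      then show ?thesis
        using m[OF ee'(2)[OF True], of y] s[OF y] by (simp add: q_def)
    qed (simp add: q_def)
    moreover have "{v. q y v \<noteq> 0} \<subset> V"
    proof -
      obtain j where "j \<in> ?I" "y j = m y"
        using m_in by blast
      then have "q y (e j) = 0" "e j \<in> V"
        using qe eV by simp_all
      moreover have "{v. q y v \<noteq> 0} \<subseteq> V"
        by (auto simp: q_def)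
      ultimately show ?thesis
        by blast
    qed
    moreover have "(\<Sum>i\<in>?I. q y (e i)) = (\<Sum>i\<in>?I. (y i - m y) / s y)"
      by (rule sum.cong) (simp_all only: qe)
    then have "(\<Sum>i\<in>?I. q y (e i)) = s y / s y"
      unfolding s_def sum_divide_distrib .
    then have "(\<Sum>i\<in>?I. q y (e i)) = 1"
      using s[OF y] by (metis divide_self less_irrefl)
    ultimately show "q y \<in> ?P"
      by (intro iffD2[OF P]) simp
    have y0: "y i = 0" if "i > d" for i
      using that y by simp
    have diff: "q y (e i) - q y (e (Suc d)) = y i / s y" if "i \<le> d" for i
      using qe[of i] qe[of "Suc d"] that y0[of "Suc d"] by (simp add: diff_divide_distrib)
    have "(\<Sum>i\<le>d. (q y (e i) - q y (e (Suc d)))\<^sup>2) = (\<Sum>i\<le>d. (y i)\<^sup>2) / (s y)\<^sup>2"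
      unfolding sum_divide_distrib by (rule sum.cong) (simp_all add: diff power_divide)
    also have "\<dots> = (1 / s y)\<^sup>2"
      using y by (simp add: power_divide)
    finally have "N (q y) = 1 / s y"
      unfolding N_def using s[OF y] by (simp only: real_sqrt_abs) simp
    then show "p (q y) = y"
      using s[OF y] diff y0 by (auto simp: p_def fun_eq_iff)
  qed
  have "continuous_on ?P p"
  proof (rule continuous_on_coordinatewise_then_product)
    have "continuous_on ?P (\<lambda>x. (x (e i) - x (e (Suc d))) / N x)" for i
      unfolding N_def
      by (intro continuous_intros continuous_on_coordinate) (use N in \<open>force simp: N_def\<close>)
    then show "continuous_on ?P (\<lambda>x. p x i)" for i
      unfolding p_def by (cases "i \<le> d") simp_all
  qed
  moreover have "continuous_on ?S q"
  proof (rule continuous_on_coordinatewise_then_product)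
    have m: "continuous_on ?S m"
      unfolding m_def by (intro continuous_on_Min_image continuous_on_coordinate) auto
    have "continuous_on ?S (\<lambda>y. (y i - m y) / s y)" for i
      unfolding s_def
      by (intro continuous_intros continuous_on_coordinate m) (use s in \<open>force simp: s_def\<close>)
    then show "continuous_on ?S (\<lambda>y. q y v)" for v
      unfolding q_def by (cases "v \<in> V") simp_all
  qed
  ultimately have "?P homeomorphic ?S"
    unfolding homeomorphic_minimal using pP qS by blast
  then show ?thesis
    unfolding geometric_realization_polyhedron nsph homeomorphic_space_iff_homeomorphic .
qed

text \<open>The complex generated by \<F>, together with the cone with apex w over the complex
  generated by \<R>. In use, \<F> lists the facets of a shelled ball and \<R> the ridges of its
  boundary; for empty \<R> with nonempty \<F>, just the complex of \<F> remains.\<close>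

definition capped :: "'a \<Rightarrow> 'a set set \<Rightarrow> 'a set set \<Rightarrow> 'a set set" where
  "capped w \<F> \<R> = {G. \<exists>F\<in>\<F>. G \<subseteq> F} \<union> {G. \<exists>Q\<in>\<R>. G \<subseteq> insert w Q}"

text \<open>A proper subset of \<open>insert w F\<close> either misses w and lies in F, or misses
  some v in F and lies in the cone over F - {v}. This is the start of every shelling.\<close>

lemma capped_simplex:
  assumes "w \<notin> F"
  shows "capped w {F} ((\<lambda>v. F - {v}) ` F) = {G. G \<subset> insert w F}"
proof (intro equalityI subsetI)
  fix G assume "G \<in> {G. G \<subset> insert w F}"
  then obtain v where "v \<in> insert w F" "v \<notin> G" "G \<subseteq> insert w F"
    by blast
  then have "G \<subseteq> F \<or> v \<in> F \<and> G \<subseteq> insert w (F - {v})"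
    by blast
  then show "G \<in> capped w {F} ((\<lambda>v. F - {v}) ` F)"
    unfolding capped_def by auto
next
  fix G assume "G \<in> capped w {F} ((\<lambda>v. F - {v}) ` F)"
  then consider "G \<subseteq> F" | v where "v \<in> F" "G \<subseteq> insert w (F - {v})"
    unfolding capped_def by auto
  then show "G \<in> {G. G \<subset> insert w F}"
    using assms by cases auto
qed

text \<open>Gluing F flips A = \<open>insert w (F - R)\<close> against R. Since R lies in no earlier
  facet, it is a missing face. By \<open>star\<close> and \<open>ridge\<close> the link of A is the
  boundary of R: boundary ridges above F - R stay inside F, and F - {v} is already part of the
  boundary for each v in R. The ridges opposite to the vertices of F - R are the new piece of the
  boundary. For R = F the set A is the apex alone, and the cone disappears.\<close>

lemma capped_shelling_step:
  fixes w :: 'a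
  assumes fin: "finite \<F>" "\<And>F. F \<in> \<F> \<Longrightarrow> finite F" "finite \<R>" "finite F"
    and w: "w \<notin> F" "\<And>G. G \<in> \<F> \<Longrightarrow> w \<notin> G"
    and bd: "\<And>Q. Q \<in> \<R> \<Longrightarrow> \<exists>G\<in>\<F>. Q \<subseteq> G"
    and R: "R \<subseteq> F" "R \<noteq> {}" "\<And>G. G \<in> \<F> \<Longrightarrow> \<not> R \<subseteq> G"
    and star: "\<And>Q. Q \<in> \<R> \<Longrightarrow> F - R \<subseteq> Q \<Longrightarrow> Q \<subseteq> F"
    and ridge: "\<And>v. v \<in> R \<Longrightarrow> \<exists>Q\<in>\<R>. F - {v} \<subseteq> Q"
  shows "polyhedron (capped w \<F> \<R>) homeomorphic
    polyhedron (capped w (insert F \<F>) ({Q \<in> \<R>. \<not> F - R \<subseteq> Q} \<union> (\<lambda>v. F - {v}) ` (F - R)))"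
proof -
  let ?K = "capped w \<F> \<R>" and ?A = "insert w (F - R)"
  let ?L = "capped w (insert F \<F>) ({Q \<in> \<R>. \<not> F - R \<subseteq> Q} \<union> (\<lambda>v. F - {v}) ` (F - R))"
  have finR: "finite Q" if "Q \<in> \<R>" for Q
    using bd[OF that] fin(2) finite_subset by blast
  have "?K = (\<Union>F\<in>\<F>. Pow F) \<union> (\<Union>Q\<in>\<R>. Pow (insert w Q))"
    unfolding capped_def by blast
  then have finK: "finite ?K"
    using fin finR by simp
  have finG: "finite G" if "G \<in> ?K" for G
    using that fin(2) finR unfolding capped_def by (auto intro: finite_subset)
  have A: "finite ?A" "?A \<noteq> {}" "finite R" "?A \<inter> R = {}"
    using fin(4) R(1) w(1) finite_subset by auto
  have KB: "\<not> R \<subseteq> G" if G: "G \<in> ?K" for G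
  proof
    assume RG: "R \<subseteq> G"
    from G consider H where "H \<in> \<F>" "G \<subseteq> H" | Q where "Q \<in> \<R>" "G \<subseteq> insert w Q"
      unfolding capped_def by blast
    then have "\<exists>H\<in>\<F>. R \<subseteq> H"
    proof cases
      case 1
      then show ?thesis
        using RG by blast
    next
      case 2
      then have "R \<subseteq> Q"
        using RG w(1) R(1) by blast
      then show ?thesis
        using bd[OF 2(1)] by blast
    qed
    then obtain H where "H \<in> \<F>" "R \<subseteq> H"
      by blast
    then show False
      using R(3) by blast
  qed
  \<comment> \<open>A face that contains w comes from the cone, so it lies over a single boundary
    ridge Q.\<close>
  have KA: "G \<subseteq> ?A \<union> R" if G: "G \<in> ?K" "?A \<subseteq> G" for G
  proof -
    obtain Q where Q: "Q \<in> \<R>" "G \<subseteq> insert w Q"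
      using G w(2) unfolding capped_def by blast
    then have "F - R \<subseteq> Q"
      using G(2) w(1) by blast
    then show ?thesis
      using star[OF Q(1)] Q(2) by blast
  qed
  have AK: "G \<in> ?K" if G: "G \<subseteq> insert w F" "\<not> R \<subseteq> G" for G
  proof -
    obtain v where v: "v \<in> R" "v \<notin> G"
      using G(2) by blast
    obtain Q where "Q \<in> \<R>" "F - {v} \<subseteq> Q"
      using ridge[OF v(1)] by blast
    then have "G \<subseteq> insert w Q"
      using G(1) v(2) by blast
    then show ?thesis
      using \<open>Q \<in> \<R>\<close> unfolding capped_def by blast
  qed
  have AR: "?A \<union> R = insert w F"
    using R(1) by blast
  have AK': "G \<in> ?K" if "?A \<subseteq> G" "G \<subseteq> ?A \<union> R" "\<not> R \<subseteq> G" for G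
    using AK[of G] that(2,3) unfolding AR .
  have "polyhedron ?K homeomorphic polyhedron (flip ?A R ?K)"
    by (rule flip_homeomorphic[OF finK finG A(1,2,3) R(2) A(4) KB KA AK'])
  moreover have "flip ?A R ?K = ?L"
  proof (intro equalityI subsetI)
    fix G assume "G \<in> flip ?A R ?K"
    then have nA: "\<not> ?A \<subseteq> G" and G: "G \<in> ?K \<or> G \<subseteq> insert w F"
      unfolding flip_def using AR by blast+
    \<comment> \<open>The missing element a decides where G lies: in F if a = w, and in the cone
      over the new ridge F - {a} if a is in F - R.\<close>
    have F: "G \<in> ?L" if G: "G \<subseteq> insert w F"
    proof -
      obtain a where a: "a \<in> ?A" "a \<notin> G"
        using nA by blast
      then have "G \<subseteq> F \<or> a \<in> F - R \<and> G \<subseteq> insert w (F - {a})"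
        using G by blast
      then show ?thesis
        unfolding capped_def by blast
    qed
    from G show "G \<in> ?L"
    proof
      assume "G \<in> ?K"
      then consider H where "H \<in> \<F>" "G \<subseteq> H" | Q where "Q \<in> \<R>" "G \<subseteq> insert w Q"
        unfolding capped_def by blast
      then show ?thesis
      proof cases
        case 1
        then show ?thesis
          unfolding capped_def by blast
      next
        case 2
        show ?thesis
        proof (cases "F - R \<subseteq> Q")
          case True
          then show ?thesis
            using star[OF 2(1)] 2(2) by (intro F) blast
        next
          case False
          then show ?thesis
            using 2 unfolding capped_def by blast
        qed
      qed
    qed (rule F)
  next
    fix G assume "G \<in> ?L"
    then consider H where "H \<in> \<F>" "G \<subseteq> H" | "G \<subseteq> F"
      | Q where "Q \<in> \<R>" "\<not> F - R \<subseteq> Q" "G \<subseteq> insert w Q"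
      | v where "v \<in> F - R" "G \<subseteq> insert w (F - {v})"
      unfolding capped_def by blast
    then have "\<not> ?A \<subseteq> G \<and> (G \<in> ?K \<or> G \<subseteq> insert w F)"
    proof cases
      case 1
      then show ?thesis
        using w(2) unfolding capped_def by blast
    next
      case 3
      then show ?thesis
        using w(1) unfolding capped_def by blast
    qed (use w(1) in blast)+
    then show "G \<in> flip ?A R ?K"
      unfolding flip_def AR using AK[of G] by blast
  qed
  ultimately show ?thesis
    by simp
qed

section \<open>Checking shellings by rewriting\<close>

text \<open>A face is encoded by a binary numeral: the least significant bit stands for vertex 1, and the
  leading bit only marks the end. Working on the type of numerals lets the simplifier compute
  with the digits directly.\<close>

fun bits :: "nat \<Rightarrow> num \<Rightarrow> nat set" where
  "bits i num.One = {}"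
| "bits i (num.Bit0 m) = bits (Suc i) m"
| "bits i (num.Bit1 m) = insert i (bits (Suc i) m)"

fun num_len :: "num \<Rightarrow> nat" where
  "num_len num.One = 0"
| "num_len (num.Bit0 m) = Suc (num_len m)"
| "num_len (num.Bit1 m) = Suc (num_len m)"

fun num_card :: "num \<Rightarrow> nat" where
  "num_card num.One = 0"
| "num_card (num.Bit0 m) = num_card m"
| "num_card (num.Bit1 m) = Suc (num_card m)"

fun num_sub :: "num \<Rightarrow> num \<Rightarrow> bool" where
  "num_sub num.One n = True"
| "num_sub (num.Bit0 m) num.One = num_sub m num.One"
| "num_sub (num.Bit1 m) num.One = False"
| "num_sub (num.Bit0 m) (num.Bit0 n) = num_sub m n"
| "num_sub (num.Bit0 m) (num.Bit1 n) = num_sub m n"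
| "num_sub (num.Bit1 m) (num.Bit0 n) = False"
| "num_sub (num.Bit1 m) (num.Bit1 n) = num_sub m n"

fun num_diff :: "num \<Rightarrow> num \<Rightarrow> num" where
  "num_diff num.One n = num.One"
| "num_diff (num.Bit0 m) num.One = num.Bit0 m"
| "num_diff (num.Bit1 m) num.One = num.Bit1 m"
| "num_diff (num.Bit0 m) (num.Bit0 n) = num.Bit0 (num_diff m n)"
| "num_diff (num.Bit0 m) (num.Bit1 n) = num.Bit0 (num_diff m n)"
| "num_diff (num.Bit1 m) (num.Bit0 n) = num.Bit1 (num_diff m n)"
| "num_diff (num.Bit1 m) (num.Bit1 n) = num.Bit0 (num_diff m n)"

fun num_disj :: "num \<Rightarrow> num \<Rightarrow> bool" where
  "num_disj num.One n = True"
| "num_disj (num.Bit0 m) num.One = True"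
| "num_disj (num.Bit1 m) num.One = True"
| "num_disj (num.Bit0 m) (num.Bit0 n) = num_disj m n"
| "num_disj (num.Bit0 m) (num.Bit1 n) = num_disj m n"
| "num_disj (num.Bit1 m) (num.Bit0 n) = num_disj m n"
| "num_disj (num.Bit1 m) (num.Bit1 n) = False"

text \<open>One deletion for each element of n that occurs in m. With n = m these are all ridges of
  a facet; with n = R the ridges that must already be in the boundary; with n = F - R the new
  boundary ridges.\<close>

fun num_dels :: "num \<Rightarrow> num \<Rightarrow> num list" where
  "num_dels num.One n = []"
| "num_dels (num.Bit0 m) num.One = []"
| "num_dels (num.Bit1 m) num.One = []"
| "num_dels (num.Bit0 m) (num.Bit0 n) = map num.Bit0 (num_dels m n)"
| "num_dels (num.Bit0 m) (num.Bit1 n) = map num.Bit0 (num_dels m n)"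
| "num_dels (num.Bit1 m) (num.Bit0 n) = map num.Bit1 (num_dels m n)"
| "num_dels (num.Bit1 m) (num.Bit1 n) = num.Bit0 m # map num.Bit1 (num_dels m n)"

fun num_drop :: "nat \<Rightarrow> num \<Rightarrow> num" where
  "num_drop 0 m = m"
| "num_drop (Suc k) num.One = num.One"
| "num_drop (Suc k) (num.Bit0 m) = num_drop k m"
| "num_drop (Suc k) (num.Bit1 m) = num_drop k m"

fun num_append :: "num \<Rightarrow> num \<Rightarrow> num" where
  "num_append num.One n = n"
| "num_append (num.Bit0 m) n = num.Bit0 (num_append m n)"
| "num_append (num.Bit1 m) n = num.Bit1 (num_append m n)"

text \<open>The lowest digit moves to the top: on facets with n digits, vertex 1 becomes n and any
  other v becomes v - 1, which is the inverse of the n-cycle.\<close>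

fun num_rotate :: "num \<Rightarrow> num" where
  "num_rotate num.One = num.One"
| "num_rotate (num.Bit0 m) = num_append m (num.Bit0 num.One)"
| "num_rotate (num.Bit1 m) = num_append m (num.Bit1 num.One)"

text \<open>The faces with l vertices of the boundary of the k-dimensional crosspolytope: pairs of
  disjoint subsets of {1..k}, the second one standing for antipodes. Each component has exactly k
  digits, so appending them puts the second set at k + 1, ..., 2k.\<close>

fun num_signed :: "nat \<Rightarrow> nat \<Rightarrow> (num \<times> num) list" where
  "num_signed 0 0 = [(num.One, num.One)]"
| "num_signed 0 (Suc l) = []"
| "num_signed (Suc k) 0 = map (\<lambda>(x, y). (num.Bit0 x, num.Bit0 y)) (num_signed k 0)"
| "num_signed (Suc k) (Suc l) =
    map (\<lambda>(x, y). (num.Bit0 x, num.Bit0 y)) (num_signed k (Suc l)) @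
    map (\<lambda>(x, y). (num.Bit1 x, num.Bit0 y)) (num_signed k l) @
    map (\<lambda>(x, y). (num.Bit0 x, num.Bit1 y)) (num_signed k l)"

text \<open>With a strict first argument, the simplifier stops at the first superset it meets.\<close>

definition or_else :: "bool \<Rightarrow> num \<Rightarrow> num list \<Rightarrow> bool" where
  "or_else b m ns \<longleftrightarrow> b \<or> list_ex (num_sub m) ns"

lemma list_ex_num_sub_code:
  "list_ex (num_sub m) [] = False"
  "list_ex (num_sub m) (n # ns) = or_else (num_sub m n) m ns"
  "or_else True m ns = True"
  "or_else False m ns = list_ex (num_sub m) ns"
  by (simp_all add: or_else_def)

text \<open>Matching on the evaluated test and on an explicit pair takes the place of
  \<open>if\<close> and \<open>let\<close>: the equations apply to computed values only and
  duplicate no unevaluated term.\<close>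

fun route :: "bool \<Rightarrow> 'a \<Rightarrow> 'a list \<times> 'a list \<Rightarrow> 'a list \<times> 'a list" where
  "route True x (ys, zs) = (x # ys, zs)"
| "route False x (ys, zs) = (ys, x # zs)"

fun num_split :: "num \<Rightarrow> num list \<Rightarrow> num list \<times> num list" where
  "num_split m [] = ([], [])"
| "num_split m (n # ns) = route (num_sub m n) n (num_split m ns)"

fun new_face :: "num \<Rightarrow> num \<Rightarrow> (num \<times> num) list \<Rightarrow> bool" where
  "new_face R F [] = (\<not> num_sub R F)"
| "new_face R F ((G, S) # xs) = (\<not> num_sub R G \<and> new_face R F xs)"

text \<open>F is the facet being glued and R its new face; \<open>ms\<close> and \<open>ns\<close>
  are the boundary ridges that contain F - R and those that do not. The tests are the conditions of
  a shelling step, and the second component is the boundary after gluing.\<close>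

fun glue' :: "num \<Rightarrow> num \<Rightarrow> bool \<Rightarrow> num list \<times> num list \<Rightarrow> bool \<times> num list" where
  "glue' F R b (ms, ns) =
    (b \<and> num_sub R F \<and> list_all (\<lambda>q. num_sub q F) ms \<and>
       list_all (\<lambda>p. list_ex (num_sub p) ms) (num_dels F R),
     num_dels F (num_diff F R) @ ns)"

fun glue :: "num \<Rightarrow> num \<Rightarrow> bool \<Rightarrow> bool \<times> num list \<Rightarrow> bool \<times> num list" where
  "glue F R b (c, qs) = glue' F R (b \<and> c) (num_split (num_diff F R) qs)"

text \<open>The shelling starts with F and is listed backwards, each facet together with its unique
  minimal new face; the second component of the result lists the ridges of the boundary.\<close>

fun shelling :: "num \<Rightarrow> (num \<times> num) list \<Rightarrow> bool \<times> num list" where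
  "shelling F [] = (True, num_dels F F)"
| "shelling F ((G, R) # xs) = glue G R (new_face R F xs) (shelling F xs)"

section \<open>Correctness of the set operations on numerals\<close>

lemma bits_ge: "v \<in> bits i m \<Longrightarrow> i \<le> v"
  by (induction i m rule: bits.induct) (auto dest: Suc_leD)

lemma not_in_bits_Suc [simp]: "i \<notin> bits (Suc i) m"
  using bits_ge by fastforce

lemma bits_less: "v \<in> bits i m \<Longrightarrow> v < i + num_len m"
  by (induction i m rule: bits.induct) auto

lemma bits_subset: "bits i m \<subseteq> {i..<i + num_len m}"
  using bits_ge bits_less by fastforce

lemma finite_bits [simp]: "finite (bits i m)"
  by (induction i m rule: bits.induct) auto

lemma card_bits: "card (bits i m) = num_card m"
  by (induction i m rule: bits.induct) auto

lemma bits_add: "bits (i + k) m = (\<lambda>v. v + k) ` bits i m"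
  by (induction i m rule: bits.induct) (auto simp flip: add_Suc)

lemma num_sub_iff: "num_sub m n \<longleftrightarrow> bits i m \<subseteq> bits i n"
  by (induction m n arbitrary: i rule: num_sub.induct) (auto simp: subset_insert)

lemma bits_num_diff: "bits i (num_diff m n) = bits i m - bits i n"
  by (induction m n arbitrary: i rule: num_diff.induct) auto

lemma num_disjD: "num_disj m n \<Longrightarrow> bits i m \<inter> bits i n = {}"
  by (induction m n arbitrary: i rule: num_disj.induct) auto

text \<open>The inclusion excludes elements of n outside m: on the right they would contribute m
  itself, on the left no entry. Where m has the digit i, the deletions further up keep it, whence
  \<open>insert i\<close> in the inductive cases.\<close>

lemma bits_num_dels:
  "bits i n \<subseteq> bits i m \<Longrightarrow> bits i ` set (num_dels m n) = (\<lambda>v. bits i m - {v}) ` bits i n"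
proof (induction m n arbitrary: i rule: num_dels.induct)
  case (6 m n)
  let ?X = "bits (Suc i) m" and ?N = "bits (Suc i) n"
  have "?N \<subseteq> ?X"
    using 6(2) by (simp add: subset_insert)
  then have IH: "bits (Suc i) ` set (num_dels m n) = (\<lambda>v. ?X - {v}) ` ?N"
    by (rule 6(1))
  have "bits i ` set (num_dels (num.Bit1 m) (num.Bit0 n)) = insert i ` bits (Suc i) ` set (num_dels m n)"
    by (simp add: image_image)
  also have "\<dots> = (\<lambda>v. insert i ?X - {v}) ` ?N"
    unfolding IH image_image by (intro image_cong) auto
  finally show ?case
    by simp
next
  case (7 m n)
  let ?X = "bits (Suc i) m" and ?N = "bits (Suc i) n"
  have "?N \<subseteq> ?X"
    using 7(2) not_in_bits_Suc[of i n] by auto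
  then have IH: "bits (Suc i) ` set (num_dels m n) = (\<lambda>v. ?X - {v}) ` ?N"
    by (rule 7(1))
  have "bits i ` set (num_dels (num.Bit1 m) (num.Bit1 n))
      = insert ?X (insert i ` bits (Suc i) ` set (num_dels m n))"
    by (simp add: image_image)
  also have "insert i ` bits (Suc i) ` set (num_dels m n) = (\<lambda>v. insert i ?X - {v}) ` ?N"
    unfolding IH image_image by (intro image_cong) auto
  finally show ?case
    by simp
qed (auto simp: image_image)

lemma bits_Suc: "bits (Suc i) m = Suc ` bits i m"
  using bits_add[of i 1 m] by simp

lemma bits_num_drop: "i \<le> v \<Longrightarrow> v \<in> bits i (num_drop k m) \<longleftrightarrow> v + k \<in> bits i m"
  by (induction k m rule: num_drop.induct) (auto simp: bits_Suc)

text \<open>Completeness of the enumeration: the smallest vertex i lies in A, in B or in neither,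
  and these are the three branches of \<open>num_signed\<close>.\<close>

lemma bits_num_signed:
  assumes "A \<inter> B = {}" "A \<subseteq> {i..<i + k}" "B \<subseteq> {i..<i + k}" "card A + card B = l"
  shows "\<exists>p\<in>set (num_signed k l). bits i (fst p) = A \<and> bits i (snd p) = B \<and> num_len (fst p) = k"
  using assms
proof (induction k arbitrary: i l A B)
  case 0
  then show ?case
    by auto
next
  case (Suc k)
  have fin: "finite A" "finite B"
    using Suc.prems finite_subset by blast+
  have sub: "A - {i} \<subseteq> {Suc i..<Suc i + k}" "B - {i} \<subseteq> {Suc i..<Suc i + k}"
    using Suc.prems by auto
  consider "i \<in> A" "i \<notin> B" | "i \<notin> A" "i \<in> B" | "i \<notin> A" "i \<notin> B"
    using Suc.prems(1) by blast
  then show ?case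
  proof cases
    case 1
    then have "card A + card B = Suc (card (A - {i}) + card (B - {i}))"
      using card_Suc_Diff1[OF fin(1)] by fastforce
    then obtain l' where l: "l = Suc l'" "card (A - {i}) + card (B - {i}) = l'"
      using Suc.prems(4) by simp
    obtain p where p: "p \<in> set (num_signed k l')" "bits (Suc i) (fst p) = A - {i}"
        "bits (Suc i) (snd p) = B - {i}" "num_len (fst p) = k"
      using Suc.IH[OF _ sub l(2)] Suc.prems(1) by blast
    show ?thesis
      by (rule bexI[of _ "(num.Bit1 (fst p), num.Bit0 (snd p))"])
        (use 1 p in \<open>force simp: l(1) case_prod_unfold\<close>)+
  next
    case 2
    then have "card A + card B = Suc (card (A - {i}) + card (B - {i}))"
      using card_Suc_Diff1[OF fin(2)] by fastforce
    then obtain l' where l: "l = Suc l'" "card (A - {i}) + card (B - {i}) = l'"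
      using Suc.prems(4) by simp
    obtain p where p: "p \<in> set (num_signed k l')" "bits (Suc i) (fst p) = A - {i}"
        "bits (Suc i) (snd p) = B - {i}" "num_len (fst p) = k"
      using Suc.IH[OF _ sub l(2)] Suc.prems(1) by blast
    show ?thesis
      by (rule bexI[of _ "(num.Bit0 (fst p), num.Bit1 (snd p))"])
        (use 2 p in \<open>force simp: l(1) case_prod_unfold\<close>)+
  next
    case 3
    obtain p where p: "p \<in> set (num_signed k l)" "bits (Suc i) (fst p) = A - {i}"
        "bits (Suc i) (snd p) = B - {i}" "num_len (fst p) = k"
      using Suc.IH[OF _ sub] Suc.prems(1,4) 3 by force
    show ?thesis
      by (rule bexI[of _ "(num.Bit0 (fst p), num.Bit0 (snd p))"])
        (use 3 p in \<open>cases l; force simp: case_prod_unfold\<close>)+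
  qed
qed

lemma bits_num_append: "bits i (num_append m n) = bits i m \<union> bits (i + num_len m) n"
  by (induction m arbitrary: i) auto

section \<open>Correctness of the shelling check\<close>

lemma num_split_eq:
  "num_split m ns = (filter (num_sub m) ns, filter (\<lambda>n. \<not> num_sub m n) ns)"
proof (induction ns)
  case (Cons n ns)
  then show ?case
    by (cases "num_sub m n") simp_all
qed simp

lemma new_face_iff: "new_face R F xs \<longleftrightarrow> (\<forall>G\<in>set (F # map fst xs). \<not> num_sub R G)"
  by (induction R F xs rule: new_face.induct) auto

text \<open>Induction along the shelling. The second conjunct is the invariant that
  \<open>capped_shelling_step\<close> needs in order to see that R is a missing face of the cone as
  well. Vertex 0 can be the apex because the encoded sets start at 1.\<close>

lemma shelling_sphere:
  assumes "shelling F xs = (True, Qs)"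
  shows "polyhedron (capped 0 (bits 1 ` set (F # map fst xs)) (bits 1 ` set Qs)) homeomorphic
      polyhedron {G. G \<subset> insert 0 (bits 1 F)}
    \<and> (\<forall>Q\<in>set Qs. \<exists>G\<in>set (F # map fst xs). bits 1 Q \<subseteq> bits 1 G)"
  using assms
proof (induction xs arbitrary: Qs)
  case Nil
  have 0: "0 \<notin> bits 1 F"
    using bits_ge[of 0 1 F] by auto
  have Qs: "bits 1 ` set Qs = (\<lambda>v. bits 1 F - {v}) ` bits 1 F"
    using Nil bits_num_dels[of 1 F F] by simp
  have "\<forall>X\<in>bits 1 ` set Qs. X \<subseteq> bits 1 F"
    unfolding Qs by auto
  then show ?case
    using capped_simplex[OF 0] Qs by (simp add: homeomorphic_refl)
next
  case (Cons x xs)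
  obtain G R where x: "x = (G, R)"
    by fastforce
  obtain c qs where sh: "shelling F xs = (c, qs)"
    by fastforce
  define ms where "ms = filter (num_sub (num_diff G R)) qs"
  define ns where "ns = filter (\<lambda>q. \<not> num_sub (num_diff G R) q) qs"
  have sp: "num_split (num_diff G R) qs = (ms, ns)"
    unfolding ms_def ns_def by (rule num_split_eq)
  let ?L = "set (F # map fst xs)"
  have c: c and nf: "\<forall>H\<in>?L. \<not> num_sub R H" and RG: "num_sub R G"
    and all: "\<forall>q\<in>set ms. num_sub q G"
    and ex: "\<forall>p\<in>set (num_dels G R). \<exists>q\<in>set ms. num_sub p q"
    and Qs: "Qs = num_dels G (num_diff G R) @ ns"
    using Cons.prems by (auto simp: x sh sp new_face_iff list_all_iff list_ex_iff simp del: set_simps list.set)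
  note IH = Cons.IH[OF sh[unfolded eqTrueI[OF c]]]
  let ?\<F> = "bits 1 ` ?L" and ?\<R> = "bits 1 ` set qs" and ?G = "bits 1 G" and ?R = "bits 1 R"
  have split: "set ms = {q \<in> set qs. ?G - ?R \<subseteq> bits 1 q}" "set ns = {q \<in> set qs. \<not> ?G - ?R \<subseteq> bits 1 q}"
    by (simp_all add: ms_def ns_def num_sub_iff[of _ _ 1] bits_num_diff)
  have RG': "?R \<subseteq> ?G"
    using RG num_sub_iff by blast
  have R: "\<not> ?R \<subseteq> H" if H: "H \<in> ?\<F>" for H
  proof -
    obtain h where h: "h \<in> ?L" "H = bits 1 h"
      using H by blast
    show ?thesis
      using bspec[OF nf h(1)] unfolding h(2) num_sub_iff[of R h 1] .
  qed
  have w: "0 \<notin> bits 1 m" for m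
    using bits_ge[of 0 1 m] by auto
  have bd: "\<exists>H\<in>?\<F>. Q \<subseteq> H" if Q: "Q \<in> ?\<R>" for Q
  proof -
    obtain q where q: "q \<in> set qs" "Q = bits 1 q"
      using Q by blast
    show ?thesis
      unfolding q(2) using bspec[OF conjunct2[OF IH] q(1)] by (elim bexE) (rule bexI, assumption, rule imageI)
  qed
  have star: "Q \<subseteq> ?G" if Q: "Q \<in> ?\<R>" "?G - ?R \<subseteq> Q" for Q
  proof -
    obtain q where q: "q \<in> set qs" "Q = bits 1 q"
      using Q(1) by blast
    then have "q \<in> set ms"
      using Q(2) by (simp add: split(1))
    then show ?thesis
      using all num_sub_iff[of q G 1] q(2) by simp
  qed
  have ridge: "\<exists>Q\<in>?\<R>. ?G - {v} \<subseteq> Q" if "v \<in> ?R" for v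
  proof -
    have "?G - {v} \<in> bits 1 ` set (num_dels G R)"
      using that bits_num_dels[OF RG'] by blast
    then obtain p where p: "p \<in> set (num_dels G R)" "bits 1 p = ?G - {v}"
      by auto
    then obtain q where "q \<in> set ms" "num_sub p q"
      using ex by blast
    then have "q \<in> set qs" "?G - {v} \<subseteq> bits 1 q"
      using p(2) num_sub_iff[of p q 1] by (simp_all add: split(1))
    then show ?thesis
      by blast
  qed
  have step: "polyhedron (capped 0 ?\<F> ?\<R>) homeomorphic
    polyhedron (capped 0 (insert ?G ?\<F>) ({Q \<in> ?\<R>. \<not> ?G - ?R \<subseteq> Q} \<union> (\<lambda>v. ?G - {v}) ` (?G - ?R)))"
  proof (rule capped_shelling_step)
    \<comment> \<open>R lies in no earlier facet, and the initial facet is one of these.\<close>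
    show "?R \<noteq> {}"
      using R[of "bits 1 F"] by auto
  qed (use w bd RG' R star ridge in \<open>auto simp del: set_simps list.set\<close>)
  have 1: "bits 1 ` set (num_dels G (num_diff G R)) = (\<lambda>v. ?G - {v}) ` (?G - ?R)"
    using bits_num_dels[of 1 "num_diff G R" G] by (simp add: bits_num_diff)
  have 2: "bits 1 ` set ns = {Q \<in> ?\<R>. \<not> ?G - ?R \<subseteq> Q}"
    unfolding split(2) by blast
  have Qs': "bits 1 ` set Qs = {Q \<in> ?\<R>. \<not> ?G - ?R \<subseteq> Q} \<union> (\<lambda>v. ?G - {v}) ` (?G - ?R)"
    unfolding Qs set_append image_Un 1 2 by (rule Un_commute)
  have L': "bits 1 ` set (F # map fst (x # xs)) = insert ?G ?\<F>"
    by (auto simp: x)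
  have "polyhedron (capped 0 (bits 1 ` set (F # map fst (x # xs))) (bits 1 ` set Qs)) homeomorphic
      polyhedron {G. G \<subset> insert 0 (bits 1 F)}"
    unfolding L' Qs' by (rule homeomorphic_trans[OF iffD1[OF homeomorphic_sym step] conjunct1[OF IH]])
  moreover have "\<exists>H\<in>set (F # map fst (x # xs)). bits 1 Q \<subseteq> bits 1 H" if "Q \<in> set Qs" for Q
  proof -
    have "bits 1 Q \<in> bits 1 ` set Qs"
      using that by simp
    then have "bits 1 Q \<subseteq> ?G \<or> bits 1 Q \<in> ?\<R>"
      unfolding Qs' by blast
    then show ?thesis
    proof
      assume "bits 1 Q \<in> ?\<R>"
      then obtain H where "H \<in> ?L" "bits 1 Q \<subseteq> bits 1 H"
        using bd by blast
      then show ?thesis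
        by (intro bexI[of _ H]) auto
    qed (simp add: x)
  qed
  ultimately show ?case
    by blast
qed

section \<open>Certificates for cyclic nearly neighborly spheres\<close>

definition facet_ok :: "nat \<Rightarrow> num list \<Rightarrow> num \<Rightarrow> bool" where
  "facet_ok k L G \<longleftrightarrow> num_len G = k + k \<and> num_disj (num_drop k G) G \<and>
     list_ex (num_sub (num_rotate G)) L"

definition covered :: "num list \<Rightarrow> num \<times> num \<Rightarrow> bool" where
  "covered L p \<longleftrightarrow> list_ex (num_sub (num_append (fst p) (snd p))) L"

text \<open>A facet has 2l = d + 1 vertices, and the empty list says that no boundary is left. In
  \<open>facet_ok\<close>, dropping k digits brings v + k to the place of v, so disjointness
  excludes antipodal pairs; testing the rotated facets is enough for invariance because their
  subsets follow.\<close>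

definition sphere_certificate :: "nat \<Rightarrow> nat \<Rightarrow> num \<Rightarrow> (num \<times> num) list \<Rightarrow> bool" where
  "sphere_certificate k l F xs \<longleftrightarrow>
     shelling F xs = (True, []) \<and> num_card F = l + l \<and>
     list_all (facet_ok k (F # map fst xs)) (F # map fst xs) \<and>
     list_all (covered (F # map fst xs)) (num_signed k l)"

lemma complex_automorphism_funpow:
  assumes "complex_automorphism K g"
  shows "complex_automorphism K (g ^^ m)"
proof (induction m)
  case 0
  have "bij_betw (id :: 'a \<Rightarrow> 'a) (vertices K) (vertices K)"
    by simp
  then show ?case
    unfolding complex_automorphism_def by simp
next
  case (Suc m)
  have "bij_betw (g ^^ Suc m) (vertices K) (vertices K)"
    using Suc assms bij_betw_trans[of "g ^^ m" "vertices K" "vertices K" g "vertices K"]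
    by (simp add: complex_automorphism_def)
  moreover have "(`) (g ^^ Suc m) ` K = (`) g ` (`) (g ^^ m) ` K"
    by (simp add: image_comp comp_def)
  then have "(`) (g ^^ Suc m) ` K = K"
    using Suc assms by (simp add: complex_automorphism_def)
  ultimately show ?case
    unfolding complex_automorphism_def by (intro conjI)
qed

text \<open>Rotating the digits applies the inverse cycle, stated here pointwise. The case u = n is
  the digit that moves from the bottom to the top.\<close>

lemma bits_num_rotate:
  assumes "num_len G = n" "0 < n" "u \<in> {1..n}" "std_cycle n u \<in> bits 1 G"
  shows "u \<in> bits 1 (num_rotate G)"
proof -
  have c: "std_cycle n u = u mod n + 1"
    using std_cycle_funpow[OF assms(3), of 1] assms(3) by simp
  have app: "bits 1 (num_append m b) = bits 1 m \<union> bits n b" if "Suc (num_len m) = n" for m b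
    using that by (auto simp: bits_num_append)
  show ?thesis
  proof (cases "u = n")
    case True
    then have "1 \<in> bits 1 G"
      using assms(4) c by simp
    then show ?thesis
      using True assms(1,2) app not_in_bits_Suc[of 1] by (cases G) auto
  next
    case False
    then have "Suc u \<in> bits 1 G" "u \<noteq> 0"
      using assms(3,4) c by simp_all
    then show ?thesis
      using assms(1,2) app by (cases G) (auto simp: bits_Suc)
  qed
qed

text \<open>K is generated by the listed facets on the vertices 1, ..., 2k, the symmetry is the k-th
  power of the cycle, and the identity serves as the labelling.\<close>

lemma sphere_certificate_imp_sphere:
  assumes cert: "sphere_certificate k l F xs" and "0 < l"
  shows "\<exists>(K :: nat set set) I. nearly_neighborly_cs_sphere (2 * l - 1) K I \<and>
    card (vertices K) = 2 * k \<and> cyclic_vertex_transitive K I"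
proof -
  let ?L = "set (F # map fst xs)" and ?n = "k + k"
  let ?c = "std_cycle ?n"
  define K where "K = {G. \<exists>H\<in>?L. G \<subseteq> bits 1 H}"
  define I where "I = ?c ^^ k"
  have sh: "shelling F xs = (True, [])" and card: "num_card F = l + l"
    and len: "num_len H = ?n" and disj: "num_disj (num_drop k H) H"
    and rot: "\<exists>H'\<in>?L. num_sub (num_rotate H) H'"
    and ex: "p \<in> set (num_signed k l) \<Longrightarrow> \<exists>H'\<in>?L. num_sub (num_append (fst p) (snd p)) H'"
    if "H \<in> ?L" for H p
    using cert that unfolding sphere_certificate_def facet_ok_def covered_def list_all_iff list_ex_iff by auto
  have F: "F \<in> ?L"
    by simp
  note rot = rot and ex = ex[OF F] and sh = sh[OF F] and card = card[OF F]
  have sub: "bits 1 H \<subseteq> {1..?n}" if "H \<in> ?L" for H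
    using bits_subset[of 1 H] len[OF that] by (simp add: atLeastLessThanSuc_atLeastAtMost)
  have KD: "G \<subseteq> {1..?n}" "finite G" if "G \<in> K" for G
  proof -
    show "G \<subseteq> {1..?n}"
      using that sub unfolding K_def by blast
    then show "finite G"
      by (rule finite_subset) simp
  qed
  have "K \<subseteq> Pow {1..?n}"
    using KD(1) by blast
  then have finK: "finite K"
    by (rule finite_subset) simp
  have cap: "capped 0 (bits 1 ` ?L) (bits 1 ` set []) = K"
    unfolding capped_def K_def by simp
  have "0 \<notin> bits 1 F"
    using bits_ge[of 0 1 F] by auto
  then have "card (insert 0 (bits 1 F)) = (2 * l - 1) + 2"
    using card \<open>0 < l\<close> by (simp add: card_bits)
  then have "geometric_realization {G. G \<subset> insert 0 (bits 1 F)} homeomorphic_space nsphere (2 * l - 1)"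
    by (intro simplex_boundary_homeomorphic_sphere) simp_all
  moreover have "geometric_realization K homeomorphic_space geometric_realization {G. G \<subset> insert 0 (bits 1 F)}"
    using conjunct1[OF shelling_sphere[OF sh]] unfolding cap
    by (simp add: geometric_realization_polyhedron homeomorphic_space_iff_homeomorphic)
  ultimately have "geometric_realization K homeomorphic_space nsphere (2 * l - 1)"
    using homeomorphic_space_trans by blast
  moreover have "{} \<in> K" "\<And>G H. H \<in> K \<Longrightarrow> G \<subseteq> H \<Longrightarrow> G \<in> K"
    using F unfolding K_def by blast+
  then have "abstract_complex K"
    unfolding abstract_complex_def using finK KD(2) by blast
  ultimately have sphere: "simplicial_sphere (2 * l - 1) K"
    unfolding simplicial_sphere_def by blast
  have c_in: "?c v \<in> {1..?n}" if "v \<in> {1..?n}" for v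
    using std_cycle_funpow_in[OF that, of 1] by simp
  have cn: "(?c ^^ ?n) v = v" if "v \<in> {1..?n}" for v
  proof -
    have *: "(v - 1 + ?n) mod ?n = v - 1"
      unfolding mod_add_self2 using that by (intro mod_less) auto
    show ?thesis
      unfolding std_cycle_funpow[OF that] * using that by simp
  qed
  \<comment> \<open>The certificate tests rotation by one step backwards, which is the inverse r of
    the cycle.\<close>
  define r where "r = ?c ^^ (?n - 1)"
  have "bits 1 F \<noteq> {}"
    using card \<open>0 < l\<close> by (metis add_gr_0 card.empty card_bits less_irrefl)
  then have n0: "0 < ?n"
    using sub[OF F] by fastforce
  have rc: "r (?c v) = v" "?c (r v) = v" if "v \<in> {1..?n}" for v
  proof -
    have "Suc (?n - 1) = ?n"
      using n0 by simp
    then have "(?c ^^ (?n - 1)) (?c v) = (?c ^^ ?n) v" "?c ((?c ^^ (?n - 1)) v) = (?c ^^ ?n) v"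
      by (metis comp_apply funpow_Suc_right, metis comp_apply funpow.simps(2))
    then show "r (?c v) = v" "?c (r v) = v"
      using cn[OF that] by (simp_all add: r_def)
  qed
  have cr: "?c ` r ` G = G" if "G \<subseteq> {1..?n}" for G
    using that rc(2) by (force simp: image_iff)
  have rK: "r ` G \<in> K" if G: "G \<in> K" for G
  proof -
    obtain H where H: "H \<in> ?L" "G \<subseteq> bits 1 H"
      using G unfolding K_def by blast
    obtain H' where H': "H' \<in> ?L" "num_sub (num_rotate H) H'"
      using rot[OF H(1)] by blast
    have "r v \<in> bits 1 H'" if "v \<in> G" for v
    proof -
      have v: "v \<in> {1..?n}" "v \<in> bits 1 H"
        using that KD(1)[OF G] H(2) by blast+
      then have "r v \<in> bits 1 (num_rotate H)"
        using rc(2)[OF v(1)] std_cycle_funpow_in[OF v(1), of "?n - 1"]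
        by (intro bits_num_rotate[OF len[OF H(1)] n0]) (simp_all only: r_def)
      then show ?thesis
        using H'(2) num_sub_iff[of _ H' 1] by blast
    qed
    then show ?thesis
      using H'(1) unfolding K_def by blast
  qed
  then have "(`) r ` K \<subseteq> K"
    by blast
  \<comment> \<open>An injective self map of the finite set K is onto, so mapping K into itself
    already gives equality, and this passes from r to the cycle.\<close>
  moreover have "inj_on ((`) r) K"
    using cr KD(1) by (metis (no_types, lifting) inj_onI)
  ultimately have "(`) r ` K = K"
    using endo_inj_surj[OF finK] by blast
  then have "(`) ?c ` K = (`) ?c ` (`) r ` K"
    by simp
  also have "\<dots> = K"
    using cr KD(1) by (simp add: image_image)
  finally have cK: "(`) ?c ` K = K" .
  have ciK: "(?c ^^ m) ` G \<in> K" if "G \<in> K" for m G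
  proof (induction m)
    case (Suc m)
    have "?c ` (?c ^^ m) ` G \<in> K"
      using imageI[OF Suc, of "(`) ?c"] unfolding cK .
    then show ?case
      by (simp add: image_comp)
  qed (use that in simp)
  have V: "vertices K = {1..?n}"
  proof
    show "vertices K \<subseteq> {1..?n}"
      using KD(1) unfolding vertices_def by (rule Union_least)
    show "{1..?n} \<subseteq> vertices K"
    proof
      fix u assume u: "u \<in> {1..?n}"
      obtain v where v: "v \<in> bits 1 F"
        using \<open>bits 1 F \<noteq> {}\<close> by blast
      then have v': "v \<in> {1..?n}"
        using sub[OF F] by blast
      have "bits 1 F \<in> K"
        using F unfolding K_def by blast
      \<comment> \<open>This power takes v to u; the full period is added so that the subtraction of
        naturals is not cut off at 0.\<close>
      then have "(?c ^^ (?n + u - v)) v \<in> vertices K"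
        using ciK v unfolding vertices_def by blast
      have 1: "v - 1 + (?n + u - v) = u - 1 + ?n"
        using u v' by auto
      have 2: "(u - 1 + ?n) mod ?n = u - 1"
        unfolding mod_add_self2 using u by (intro mod_less) auto
      have "(?c ^^ (?n + u - v)) v = u"
        unfolding std_cycle_funpow[OF v'] 1 2 using u by simp
      then show "u \<in> vertices K"
        using \<open>(?c ^^ (?n + u - v)) v \<in> vertices K\<close> by simp
    qed
  qed
  have bij: "bij_betw ?c {1..?n} {1..?n}"
  proof (rule bij_betw_byWitness[where f' = r])
    show "r ` {1..?n} \<subseteq> {1..?n}"
      unfolding r_def using std_cycle_funpow_in by blast
  qed (use rc c_in in blast)+
  have aut: "complex_automorphism K ?c"
    unfolding complex_automorphism_def V using bij cK by blast
  have II: "I (I v) = v" if "v \<in> {1..?n}" for v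
    using cn[OF that] unfolding I_def by (simp add: funpow_add)
  have I_eq: "I v = (if v \<le> k then v + k else v - k)" if "v \<in> {1..?n}" for v
  proof (cases "v \<le> k")
    case True
    then have "v - 1 + k < ?n"
      using that by simp
    then show ?thesis
      using True that unfolding I_def std_cycle_funpow[OF that] by simp
  next
    case False
    have 1: "v - 1 + k = v - k - 1 + ?n"
      using False by simp
    have 2: "(v - k - 1 + ?n) mod ?n = v - k - 1"
      unfolding mod_add_self2 using that by (intro mod_less) auto
    show ?thesis
      unfolding I_def std_cycle_funpow[OF that] 1 2 using False by simp
  qed
  have pair: "\<not> (u \<in> G \<and> u + k \<in> G)" if G: "G \<in> K" for u G
  proof
    assume u: "u \<in> G \<and> u + k \<in> G"
    obtain H where H: "H \<in> ?L" "G \<subseteq> bits 1 H"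
      using G unfolding K_def by blast
    have "1 \<le> u" "u \<in> bits 1 H" "u + k \<in> bits 1 H"
      using u H(2) KD(1)[OF G] by auto
    then show False
      using num_disjD[OF disj[OF H(1)], of 1] bits_num_drop[of 1 u k H] by blast
  qed
  \<comment> \<open>The smaller of v and I v takes the role of u in \<open>pair\<close>.\<close>
  have noanti: "I v \<notin> G" if "v \<in> G" "G \<in> K" for v G
  proof -
    have v: "v \<in> {1..?n}"
      using that KD(1) by blast
    show ?thesis
      using pair[OF that(2), of v] pair[OF that(2), of "v - k"] that(1) I_eq[OF v]
      by (auto split: if_splits)
  qed
  have cs: "central_symmetry K I"
    unfolding central_symmetry_def V
  proof (intro conjI ballI impI)
    show "complex_automorphism K I"
      unfolding I_def by (rule complex_automorphism_funpow[OF aut])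
    show "I (I v) = v" if "v \<in> {1..?n}" for v
      by (rule II[OF that])
    show "I ` G \<noteq> G" if G: "G \<in> K" "G \<noteq> {}" for G
      using G noanti by blast
  qed
  have "S \<in> K" if S: "S \<subseteq> {1..?n}" "card S = l" "\<forall>v\<in>S. I v \<notin> S" for S
  proof -
    \<comment> \<open>S is A together with B shifted by k. As S has no antipodal pair, A and B are
      disjoint, which is the form that \<open>num_signed\<close> enumerates.\<close>
    define A where "A = S \<inter> {1..k}"
    define B where "B = (\<lambda>v. v - k) ` (S \<inter> {k + 1..?n})"
    have S_eq: "S = A \<union> (\<lambda>v. v + k) ` B"
    proof -
      have "S = A \<union> (S \<inter> {k + 1..?n})"
        using S(1) unfolding A_def by force
      moreover have "(\<lambda>v. v + k) ` B = S \<inter> {k + 1..?n}"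
        unfolding B_def image_image by (force simp: image_def)
      ultimately show ?thesis
        by simp
    qed
    have AB: "A \<subseteq> {1..<1 + k}" "B \<subseteq> {1..<1 + k}"
      unfolding A_def B_def by auto
    have "A \<inter> B = {}"
    proof (rule ccontr)
      assume "A \<inter> B \<noteq> {}"
      then obtain v where v: "v \<in> A" "v \<in> B"
        by blast
      then have "v \<in> S" "v + k \<in> S" "v \<le> k"
        unfolding S_eq using AB(1) by auto
      moreover then have "I v = v + k"
        using S(1) I_eq[of v] by auto
      ultimately show False
        using S(3) by auto
    qed
    moreover have "finite A" "finite B"
      using AB finite_subset by blast+
    moreover have "card A + card B = l"
    proof -
      have "card ((\<lambda>v. v + k) ` B) = card B"
        by (rule card_image) simp
      moreover have "A \<inter> (\<lambda>v. v + k) ` B = {}"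
        using AB by force
      ultimately show ?thesis
        using S(2) \<open>finite A\<close> \<open>finite B\<close> unfolding S_eq by (simp add: card_Un_disjoint)
    qed
    ultimately obtain p where p: "p \<in> set (num_signed k l)" "bits 1 (fst p) = A"
        "bits 1 (snd p) = B" "num_len (fst p) = k"
      using bits_num_signed[OF _ AB] by blast
    then obtain H where H: "H \<in> ?L" "num_sub (num_append (fst p) (snd p)) H"
      using ex by blast
    moreover have "bits 1 (num_append (fst p) (snd p)) = S"
      unfolding bits_num_append p(2,4) bits_add p(3) by (simp add: S_eq)
    ultimately show ?thesis
      unfolding K_def using num_sub_iff[of _ H 1] by blast
  qed
  then have "centrally_neighborly l K I"
    unfolding centrally_neighborly_def V by blast
  moreover have "(2 * l - 1 + 1) div 2 = l"
    using \<open>0 < l\<close> by simp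
  ultimately have "nearly_neighborly_cs_sphere (2 * l - 1) K I"
    unfolding nearly_neighborly_cs_sphere_def using sphere cs by simp
  moreover have "cyclic_vertex_transitive K I"
    unfolding cyclic_vertex_transitive_def V Let_def
    using aut by (intro exI[of _ id]) (simp add: I_def mult_2[symmetric])
  moreover have "card (vertices K) = 2 * k"
    by (simp add: V)
  ultimately show ?thesis
    by blast
qed

section \<open>Evaluation of the certificates\<close>

definition num_pairs :: "(nat \<times> nat) list \<Rightarrow> (num \<times> num) list" where
  "num_pairs = map (map_prod num_of_nat num_of_nat)"

text \<open>Facets are typed as decimal literals. A literal already carries its binary
  \<open>num\<close>, so the encoding is read off in one rewrite.\<close>

lemma num_pairs_numeral:
  "num_pairs [] = []"
  "num_pairs ((numeral a, numeral b) # xs) = (a, b) # num_pairs xs"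
  by (simp_all add: num_pairs_def num_of_nat_numeral_eq)

text \<open>Unary forms of the parameters for the recursions over k and l; the largest value needed
  is k = 11.\<close>

lemma Suc_numerals:
  "2 = Suc (Suc 0)" "3 = Suc 2" "4 = Suc 3" "5 = Suc 4" "6 = Suc 5" "7 = Suc 6"
  "8 = Suc 7" "9 = Suc 8" "10 = Suc 9" "11 = Suc 10"
  by simp_all

text \<open>A closed set of equations on constructors; the only arithmetic left is addition of unary
  numbers.\<close>

lemmas certificate_simps =
  sphere_certificate_def facet_ok_def covered_def num_pairs_numeral num_of_nat_numeral_eq Suc_numerals
  shelling.simps glue.simps glue'.simps num_split.simps route.simps new_face.simps list_ex_num_sub_code
  num_sub.simps num_diff.simps num_disj.simps num_dels.simps num_drop.simps num_append.simps
  num_rotate.simps num_signed.simps num_len.simps num_card.simps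
  list.map append.simps list.pred_inject fst_conv snd_conv prod.case add_Suc add_0
  not_False_eq_True simp_thms

section \<open>The spheres\<close>

text \<open>The boundary of the 4-dimensional crosspolytope with its 16 facets. As a reading
  example, 421 = 256 + 128 + 32 + 4 + 1 is the facet {1,3,6,8}, where 256 = 2^8 marks the end. The
  pair (451,451) at the head is the facet glued last; its new face is the whole facet, which closes
  the sphere.\<close>

lemma sphere_certificate_3_8:
  "sphere_certificate 4 2 (num_of_nat 421) (num_pairs [
     (451,451), (331,323), (466,450), (346,322), (286,282), (406,274), (391,386), (271,258),
     (436,404), (496,400), (316,276), (376,272), (481,448), (361,320), (301,264)])"
  by (simp only: certificate_simps)

text \<open>Every centrally 2-neighborly 3-sphere with 2k vertices has 2k(k - 1) edges, and Euler's
  relation with f_2 = 2 f_3 leaves 2k(k - 2) facets: 30 here, the initial one and 29 in the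
  list.\<close>

lemma sphere_certificate_3_10:
  "sphere_certificate 5 2 (num_of_nat 1549) (num_pairs [
     (1636,1636), (1132,1124), (1612,1092), (1609,1608), (1729,1601), (1984,1728), (1888,1600),
     (1504,1344), (1264,1248), (1144,1120), (1225,1089), (1240,1088), (1456,1184), (1084,1064),
     (1828,1568), (1318,1316), (1330,1312), (1078,1056), (1798,1284), (1921,1664), (1426,1296),
     (1411,1408), (1795,1280), (1177,1160), (1171,1152), (1051,1041), (1054,1040), (1543,1538),
     (1039,1026)])"
  by (simp only: certificate_simps)

lemma sphere_certificate_3_12:
  "sphere_certificate 6 2 (num_of_nat 7178) (num_pairs [
     (4174,4174), (4426,4170), (4440,4424), (4188,4168), (6466,4418), (6592,6464), (5568,4544),
     (5472,5440), (5344,5184), (4182,4164), (4464,4416), (4832,4320), (4720,4192), (6226,4162),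
     (6848,4288), (6736,4160), (4784,4640), (4408,4368), (4280,4144), (5416,4384), (7040,6272),
     (4252,4120), (6914,6400), (4756,4240), (5386,4360), (5890,4354), (5889,5888), (4993,4864),
     (4741,4736), (7682,4610), (5637,4609), (7684,5632), (6676,4608), (7173,5124), (6165,6148),
     (4268,4232), (4119,4116), (4261,4228), (4135,4101), (4142,4100), (5505,4352), (5281,4224),
     (4139,4130), (5161,4128), (6163,4112), (7177,5121), (6155,4097)])"
  by (simp only: certificate_simps)

lemma sphere_certificate_3_14:
  "sphere_certificate 7 2 (num_of_nat 25345) (num_pairs [
     (20547,20547), (20562,20546), (20995,20483), (20506,20498), (21002,20482), (21057,20481),
     (20688,20560), (16594,16464), (23104,21056), (22720,20544), (23048,20992), (18628,18624),
     (22660,18560), (16922,16394), (22540,22528), (19016,18944), (16582,16576), (17176,16920),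
     (28696,20504), (24856,16408), (17224,16904), (28936,24584), (20620,20484), (20872,20488),
     (18502,16452), (19522,18498), (19552,19520), (17506,17472), (16483,16450), (18536,18496),
     (16489,16480), (16780,16520), (16713,16456), (16653,16648), (18445,16396), (18693,16389),
     (19462,18434), (19716,18436), (19744,19456), (17700,17664), (16804,16644), (29056,20736),
     (24992,16768), (24740,16544), (24710,16516), (25606,16390), (25730,24578), (29824,24704),
     (21648,20608), (29712,20480), (17042,16402), (18050,16514), (18064,16512), (18473,16392),
     (25620,25600), (24628,24580), (17460,16388), (17443,16418), (17923,16386), (17217,16448),
     (17968,17424), (17953,17408), (16945,16928), (25360,16656), (24625,16432), (25105,16400),
     (26912,16672), (26657,16416), (26881,18432)])"
  by (simp only: certificate_simps)

lemma sphere_certificate_3_16: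
  "sphere_certificate 8 2 (num_of_nat 99856) (num_pairs [
     (72224,72224), (104480,71712), (102944,69664), (98912,98848), (68192,66080), (72256,68096),
     (71746,71744), (67651,67650), (65619,65603), (65746,65618), (69826,65602), (65745,65616),
     (67681,67648), (65641,65633), (98408,65632), (98345,65576), (70848,69824), (66753,65728),
     (66705,65665), (66579,65553), (82947,66563), (83971,65539), (84993,81921), (104450,71680),
     (74817,66625), (78912,66624), (77889,73792), (78976,70656), (68641,67585), (77829,77825),
     (77956,77824), (99361,65569), (82962,66562), (69766,69760), (69705,65601), (85008,82944),
     (69645,69633), (68896,68640), (68880,68608), (66864,66816), (102406,69634), (99376,66592),
     (69708,69640), (100358,98306), (84240,67600), (100388,100352), (82224,65808), (98356,98336),
     (81972,65584), (114708,65556), (82212,81952), (114948,81924), (102660,98308), (70212,69696),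
     (70404,69636), (66372,66052), (98888,98368), (65868,65604), (66376,65600), (73741,65541),
     (73996,65548), (67622,67588), (65702,65542), (65956,65572), (74116,65540), (98825,98312),
     (107521,66561), (107009,98305), (74249,65537), (65954,65696), (67874,65568), (67970,65794),
     (84098,67586), (76160,65920), (92288,67712), (92416,67584), (90376,73984), (119040,98560),
     (82696,65800), (86784,65792), (90242,82048), (90122,90112), (81946,81922), (73754,65546),
     (73874,65538), (73880,73744), (74888,73856), (75272,73736), (67208,66568), (66200,65672),
     (67216,65664), (108032,73728), (119296,69632), (82456,65544), (115216,81920)])"
  by (simp only: certificate_simps)

lemma sphere_certificate_3_18:
  "sphere_certificate 9 2 (num_of_nat 271492) (num_pairs [
     (330248,330248), (328264,328200), (334336,330240), (460808,329736), (332352,328192),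
     (327768,327752), (411656,395272), (333888,331776), (327960,327704), (475144,393224),
     (329808,327744), (327954,327952), (262426,262416), (329746,327696), (460802,329728),
     (344328,327688), (280840,278536), (264968,264200), (264400,264272), (264338,264208),
     (264386,264320), (395330,264194), (271112,262920), (270920,262664), (271168,270848),
     (270657,270656), (262497,262465), (411712,395264), (270602,262408), (336130,262402),
     (352512,327936), (286977,270592), (280833,278784), (284736,264256), (393286,393282),
     (409668,393280), (278598,262212), (282690,278592), (264481,262401), (315394,282626),
     (266818,266304), (288769,278529), (292864,280576), (323584,282624), (385024,286720),
     (507904,344064), (270409,270400), (263241,262217), (263265,262209), (263272,263232),
     (262264,262216), (299522,266242), (311810,294914), (272417,264193), (270347,270344),
     (270371,270337), (335906,270338), (327715,262178), (442880,311296), (458755,327682),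
     (393223,393218), (262159,262147), (262174,262154), (262204,262168), (278550,262150),
     (410116,409600), (279060,278532), (262708,262164), (393764,262660), (393776,262688),
     (426512,393728), (491521,458752), (426001,425984), (299536,295424), (299025,294928),
     (397329,262161), (328737,262177), (336928,327712), (361473,327681), (295945,263169),
     (273440,270368), (295976,263176), (298016,263200), (297248,264224), (277504,272384),
     (269824,268288), (267792,266752), (398352,266256), (262384,262224), (393392,262192),
     (394384,393232), (406528,267264), (402560,394240), (405632,401408), (294956,262184),
     (298240,296960), (295204,294944), (296196,295168), (262624,262240), (397472,393344),
     (266656,262304), (280080,262672), (279696,263184), (278674,262160), (361476,295936),
     (262850,262210), (307328,274432), (299137,299008), (295049,294913), (263104,262208),
     (336900,328704), (279170,262146), (262285,262153), (266373,262273), (280192,278528),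
     (295052,262152), (368644,327680), (397317,262145), (265984,264192), (397348,393216),
     (266532,262176), (266628,266240), (303236,294912), (264064,262656), (263556,262400)])"
  by (simp only: certificate_simps)

lemma sphere_certificate_3_20:
  "sphere_certificate 10 2 (num_of_nat 1050432) (num_pairs [
     (1148160,1148160), (1246464,1115392), (1152000,1147904), (1250304,1115136),
     (1265664,1249280), (1167360,1118208), (1278208,1114368), (1163392,1163264),
     (1147520,1147008), (1149440,1147392), (1286144,1277952), (1157120,1146880),
     (1255424,1122304), (1376896,1114752), (1376416,1376384), (1130656,1114240),
     (1247744,1116160), (1376304,1376288), (1114168,1114160), (1376280,1114128),
     (1507840,1114624), (1523712,1245184), (1916928,1392640), (1654785,1654784),
     (1900545,1638400), (1130536,1114144), (1130499,1130497), (1376259,1114113),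
     (1376268,1376264), (1376262,1376256), (1130508,1114120), (1130502,1114112),
     (1462272,1196032), (1444352,1180160), (1855488,1327104), (1446912,1183744),
     (1840128,1314816), (1452032,1181696), (1482752,1187840), (1967104,1311744),
     (1998848,1441792), (1875968,1343488), (1845248,1318912), (1837057,1835008),
     (1593345,1589248), (1583105,1574912), (1613825,1581056), (1069059,1064961),
     (1736705,1605632), (1576963,1052673), (1703939,1572865), (1310727,1310722),
     (1212419,1179649), (1089539,1081345), (1064974,1064964), (1056775,1048579),
     (1089542,1056770), (1212422,1081346), (1703942,1179650), (1572878,1048582),
     (1703948,1572868), (1310733,1310724), (1310745,1310728), (1212428,1179652),
     (1048605,1048585), (1081372,1048588), (1212440,1081352), (1703960,1179656),
     (1572890,1572872), (1048634,1048600), (1572914,1048594), (1705216,1180672),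
     (1703984,1572880), (1704256,1704192), (1704032,1703936), (1179760,1179680),
     (1212496,1179664), (1212736,1179648), (1310769,1310736), (1048629,1048593),
     (1048692,1048624), (1313281,1312768), (1311361,1311232), (1048677,1048612),
     (1310817,1048609), (1310944,1310752), (1310913,1310720), (1098368,1081472),
     (1100288,1081856), (1107968,1083392), (1075712,1067008), (1069066,1064962),
     (1069096,1064968), (1073792,1065472), (1073312,1065088), (1077280,1064992),
     (1061024,1056800), (1061504,1056896), (1063424,1057280), (1055360,1053184),
     (1054880,1052800), (1054760,1052704), (1577986,1576960), (1572962,1572896),
     (1048682,1048610), (1053706,1052674), (1055752,1052680), (1051688,1050632),
     (1048808,1048672), (1048778,1048648), (1051808,1050656), (1573058,1048642),
     (1574146,1573888), (1573250,1572866), (1052288,1050752), (1050272,1049728),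
     (1048970,1048706), (1049000,1048712), (1049504,1048736), (1050152,1049632),
     (1049384,1048608), (1102848,1085440), (1099008,1082368), (1098048,1081600),
     (1089556,1081348), (1089616,1081360), (1105984,1081344), (1073472,1065024),
     (1074432,1065216), (1078272,1064960), (1573312,1572864), (1048773,1048641),
     (1048788,1048644), (1049040,1048768), (1048980,1048720), (1048965,1048708),
     (1049473,1048704), (1058821,1056769), (1051141,1050625), (1049349,1048577),
     (1050122,1049608), (1049354,1048584), (1058836,1056772), (1062144,1057792),
     (1061184,1057024), (1062928,1058816), (1060944,1056768), (1052164,1051136),
     (1051668,1050628), (1049364,1048836), (1050132,1048580), (1050370,1048578),
     (1056000,1053696), (1055040,1052928), (1054800,1052672), (1051968,1050880),
     (1051728,1050624), (1049424,1048848), (1050192,1048592)])"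
  by (simp only: certificate_simps)

text \<open>The 198 facets form 9 full orbits: the stabilizer of a facet acts freely on its 4
  vertices, so its order divides 4, and a nontrivial one would contain the central symmetry.\<close>

lemma sphere_certificate_3_22:
  "sphere_certificate 11 2 (num_of_nat 4457492) (num_pairs [
     (5245008,5245008), (4200528,4196432), (5247056,4194384), (7342144,5244992),
     (7342084,7342080), (5245188,5244932), (5245312,5245184), (5376128,5245056),
     (5441536,5376000), (5439616,5373952), (6326276,6293508), (7372804,6291460),
     (5275908,5242884), (5310480,5244928), (5308560,5308416), (6326336,6293504),
     (5509136,5246992), (5505048,5505040), (5243032,5242896), (4259992,4194448),
     (4233280,4196416), (5276032,5243136), (5283968,5275776), (5251208,5243008),
     (5509128,5505024), (5255176,5242888), (4233220,4229120), (4268168,4194440),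
     (7380992,5275648), (4231236,4231168), (4272136,4202504), (4261912,4259856),
     (6332544,4235264), (4196740,4196608), (4272256,4268032), (4724740,4200452),
     (4722756,4198404), (6299808,6299776), (4206752,4202624), (4262408,4261896),
     (4393472,4261888), (6295712,4194464), (4327556,4196480), (4851716,4196356),
     (4391044,4325504), (4327944,4196864), (6295681,6295680), (4264065,4198528),
     (4851720,4327424), (4259973,4259968), (4849676,4849664), (4718668,4718596),
     (4194693,4194436), (4227148,4194372), (4263945,4263936), (6295561,4198401),
     (4228356,4227332), (4228108,4227076), (4751432,4194376), (4752392,4227080),
     (4260101,4194309), (4261124,4194564), (6357001,4194313), (4293888,4195584),
     (6357512,4259848), (4817920,4228096), (6296072,6291464), (4816960,4751360),
     (4276481,4260097), (6373377,4259841), (4785216,4784128), (6324290,6324288),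
     (6324354,6324224), (4292674,4227136), (4260930,4259904), (6291650,6291458),
     (6373632,4276224), (6357760,6356992), (4195522,4194370), (6296320,6291968),
     (4292866,4292608), (4260610,4260096), (4199176,4198912), (6307969,6291457),
     (6308032,6291584), (4195082,4195072), (4719808,4195392), (4735168,4194496),
     (4325898,4194824), (4325642,4194314), (4460808,4198408), (6557952,4198656),
     (4739136,4718656), (5263424,4198464), (5787648,4214784), (4587784,4194568),
     (5255200,4206592), (6684928,4456704), (4724752,4200448), (5771296,5246976),
     (4722736,4722688), (6688768,6553600), (6426656,6295552), (6422816,6422528),
     (4329520,4198432), (4325680,4325408), (7348288,7340032), (6316096,6291520),
     (6291760,4194592), (6815792,4194352), (6823968,6291488), (6823952,6815744),
     (6316048,6299648), (6308112,6291456), (4342032,4194576), (4349968,4210704),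
     (4350208,4341760), (4227457,4194688), (4227331,4227328), (4219200,4218880),
     (4211009,4210944), (4333826,4325632), (4202817,4194624), (4202755,4194560),
     (4719746,4195456), (4735106,4718720), (5783554,4734976), (5768194,4718594),
     (5768224,5767168), (4719656,4719616), (4720680,4718600), (4197416,4194344),
     (4458520,4194328), (4459528,4196360), (4588552,4456456), (4326412,4194312),
     (4333586,4333568), (4202515,4202498), (4325395,4194322), (4358147,4194307),
     (4358658,4325378), (4227714,4227074), (4211330,4194434), (4243585,4194433),
     (4244096,4194432), (5259329,4210752), (5251168,5251072), (5242977,5242944),
     (5259297,5242881), (5260290,5242882), (5260320,5242880), (4728864,4718624),
     (4982800,4196368), (4990976,4720640), (4466720,4204544), (4213792,4195360),
     (4213762,4211712), (4212770,4212736), (4459522,4197376), (4458530,4196352),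
     (4592640,4587520), (4330512,4329472), (4326417,4325392), (4358657,4358144),
     (4326913,4325377), (4326916,4326400), (4391428,4325376), (4203537,4194321),
     (4204033,4195329), (4464736,4202528), (4204048,4203520), (4727312,4202512),
     (4727297,4203008), (4464705,4202560), (4988929,4202496), (4260358,4260352),
     (4211206,4194818), (4210726,4210690), (4456486,4194338), (4523010,4195330),
     (4521990,4194306), (4981264,4718608), (4981249,4718592), (4461584,4198400),
     (4457025,4456449), (4457056,4456512), (4194913,4194368), (4523012,4259840),
     (4227617,4194817), (4243489,4194305), (4472868,4194340), (4505632,4210720),
     (4489760,4194336), (4506112,4227072), (4473348,4210688), (4195860,4195840), (4456980,4194816)])"
  by (simp only: certificate_simps)

text \<open>A centrally 3-neighborly 5-sphere has the edges and triangles of the crosspolytope,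
  which determine its h-vector by the Dehn-Sommerville equations: (1,8,29,64,29,8,1) for 14
  vertices, with sum 140, the number of facets. The h-vector also counts the new faces in a shelling
  by size.\<close>

lemma sphere_certificate_5_14:
  "sphere_certificate 7 3 (num_of_nat 24734) (num_pairs [
     (18542,18542), (18539,18538), (18511,18506), (18479,18442), (22605,18509), (22732,22604),
     (18668,18508), (22924,22668), (22797,22540), (18860,18572), (18733,18444), (18793,18473),
     (19273,18761), (23113,18505), (31241,23049), (30985,22537), (27401,18441), (31496,26632),
     (23240,22600), (23432,22536), (19400,18952), (18920,18440), (30981,22785), (26917,18693),
     (22599,18501), (26663,18469), (30727,18437), (31747,30723), (23619,22531), (32257,30721),
     (24129,22529), (19555,18499), (27683,18435), (20289,19009), (19809,18497), (20257,19713),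
     (28193,19457), (27425,18433), (28448,18976), (24130,23616), (23234,23104), (22726,22592),
     (32512,27136), (30854,22534), (31874,30722), (24194,22530), (24448,23040), (23940,22912),
     (31876,22656), (32004,22528), (18916,18592), (27940,26880), (19812,18720), (19558,18528),
     (27686,18464), (27782,26624), (20162,18946), (20416,18944), (19654,18434), (19908,18432),
     (22083,21568), (20559,16453), (21067,20545), (18273,17665), (17265,17249), (17241,17217),
     (16761,16705), (17017,16465), (17003,16457), (18019,16449), (21448,17032), (21336,17224),
     (21456,21312), (20952,20800), (16888,16712), (17392,16720), (18400,17216), (18146,17984),
     (17018,17000), (17138,16992), (21082,16968), (21202,16960), (17892,16704), (20574,20554),
     (20694,20546), (20700,20544), (16636,16584), (16510,16456), (17652,16612), (17526,16484),
     (17622,16452), (17650,16448), (16955,16936), (18098,16546), (17971,16930), (16447,16426),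
     (25639,24610), (17463,16418), (28941,20737), (22162,17026), (22035,17922), (30225,22017),
     (29715,21505), (29203,20497), (29195,20993), (28687,20481), (25115,16899), (24607,16395),
     (25623,16387), (25369,16905), (24861,24585), (16701,16393), (26161,17921), (25393,16897),
     (25653,17409), (24885,16385), (29210,16898), (29464,16904), (30084,21508), (26020,17668),
     (26528,17696), (26288,17952), (25520,16928), (30480,29184), (26512,25088), (22416,16896),
     (24892,16660), (25016,16688), (25004,16672), (29068,16644), (29080,16648), (30096,16640),
     (25780,17440), (24764,16416), (29842,21504), (25750,17408), (28826,28688), (28814,28672),
     (20638,20480)])"
  by (simp only: certificate_simps)

text \<open>The h-vector is (1,10,47,140,47,10,1), which gives 256 facets.\<close>

lemma sphere_certificate_5_16:
  "sphere_certificate 8 3 (num_of_nat 108304) (num_pairs [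
     (87208,87208), (87202,87200), (87082,87072), (70882,70818), (70881,70880), (70825,70816),
     (103465,70697), (70954,70698), (103720,70696), (103521,70689), (105568,103520),
     (72802,70752), (103714,70944), (105506,70688), (102505,102433), (102760,102440),
     (103264,102752), (70504,69984), (70252,70248), (69741,69736), (105056,102496), (72292,70240),
     (71781,69732), (71779,71776), (69859,69728), (71719,71713), (70189,69676), (86185,69800),
     (86569,69673), (69799,69667), (70309,69669), (86689,69665), (86314,69674), (86824,69672),
     (86692,70304), (88612,70180), (119584,70432), (121376,70176), (119074,69920), (104486,71714),
     (120868,71712), (86182,69792), (118822,69664), (121348,88064), (105280,102976),
     (72516,72256), (105220,72192), (70476,70208), (119556,102912), (86665,86017), (86916,86532),
     (86920,86528), (70540,70400), (119046,118784), (86406,86020), (104710,102404),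
     (105538,72704), (104770,104448), (66157,65580), (94474,86282), (94594,86274), (94600,86272),
     (78220,70024), (78214,70016), (71875,69699), (71815,69635), (78094,78080), (72006,71936),
     (71878,71682), (69966,69892), (77902,69646), (74062,65550), (78022,69638), (74182,73734),
     (68197,65636), (82597,66208), (84517,66084), (114982,114690), (68038,65606), (66787,65760),
     (83242,65578), (82342,81926), (68707,65634), (67751,65543), (83362,81954), (84133,65573),
     (68771,65571), (68006,65670), (69026,65698), (84148,84132), (68020,67748), (82356,65700),
     (84400,65712), (85408,65952), (85153,67744), (83113,65696), (67894,67876), (100406,67622),
     (98614,65574), (101426,100386), (68914,67618), (99634,65570), (114996,65828), (116788,65572),
     (85296,67872), (99640,99616), (83256,66848), (115000,65840), (101473,66656), (115768,65592),
     (85537,84001), (85552,85024), (69169,69152), (101425,68640), (117296,84000), (116272,81968),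
     (115753,66600), (99889,66608), (116257,66592), (100976,100896), (68209,68128),
     (100465,67616), (98929,65584), (98921,65633), (99176,65632), (115496,65824), (115241,65568),
     (80068,69828), (80065,71872), (79941,71744), (80005,71680), (94346,94208), (87178,86016),
     (102730,69952), (103690,69888), (103498,102402), (70858,70658), (78026,69634), (77901,69700),
     (78469,69765), (78349,69637), (78476,69636), (76228,65732), (76226,65984), (85378,66944),
     (92546,65922), (93442,84226), (77074,68866), (93456,68864), (93202,76800), (91402,82178),
     (75971,67776), (84613,81925), (85123,68736), (91416,83200), (91162,91136), (117268,116736),
     (84628,83972), (83083,83072), (85521,69120), (84625,84480), (92291,67714), (85011,84992),
     (92179,83970), (92305,83969), (90259,90113), (82971,82946), (82075,81923), (82585,82049),
     (83481,81937), (66715,65547), (101188,68352), (67225,65561), (99148,66368), (98893,66120),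
     (99658,98314), (106828,65868), (106573,65612), (75082,65802), (107848,65864), (110665,65609),
     (111688,98376), (71305,65673), (79048,69704), (79496,69768), (79489,70272), (79369,70144),
     (79041,69760), (111625,69640), (111681,69632), (92560,83968), (68245,68224), (75925,67713),
     (76180,67712), (100630,65542), (101395,68624), (101443,68608), (100435,100353),
     (75859,67587), (100690,100354), (76114,67586), (108868,65860), (108880,67904),
     (108820,67840), (74389,65669), (76309,65557), (76357,67589), (76369,67585), (108628,108544),
     (76372,75776), (100948,67584), (116233,81921), (82828,66432), (90508,65928), (90516,65920),
     (90266,81922), (90268,90240), (82588,82048), (74396,65668), (90652,65564), (90892,81932),
     (123156,65812), (123652,82180), (123412,81924), (116248,82944), (115480,114696),
     (90904,81928), (123664,81920), (107092,65556), (107077,65604), (107276,65796),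
     (107021,65540), (73939,73731), (66771,65667), (99411,65539), (66778,66690), (73946,65666),
     (74842,65546), (107842,66880), (106834,65856), (107602,65602), (107794,65538), (74449,73745),
     (67281,65681), (75457,65665), (99921,65553), (74968,65608), (108097,65601), (108112,98368),
     (75472,65600), (75416,65664), (108041,65537), (100120,98328), (75544,65560), (108296,65544)])"
  by (simp only: certificate_simps)

text \<open>The h-vector is (1,10,46,130,256,130,46,10,1), which gives 630 facets.\<close>

lemma sphere_certificate_7_18:
  "sphere_certificate 9 4 (num_of_nat 296380) (num_pairs [
     (444563,444563), (428211,428179), (399539,395443), (415891,395411), (432306,395442),
     (448658,395410), (429233,428209), (445585,428177), (399601,399537), (415953,399505),
     (411865,411857), (395513,395473), (396473,395441), (412825,395409), (445592,412816),
     (449168,448656), (416464,415888), (412376,411856), (445080,411792), (396536,395448),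
     (397016,395480), (429720,395416), (433808,428688), (433328,428176), (397040,396496),
     (400112,395472), (401072,395408), (415827,415761), (399475,399377), (395387,395377),
     (460859,395323), (460891,395291), (460922,395290), (493619,395315), (399986,399472),
     (497714,428082), (461426,395378), (465458,395314), (509971,428051), (514066,428050),
     (477267,395283), (416338,399440), (477778,395346), (481810,395282), (445976,428056),
     (450064,428560), (515088,448528), (482832,415760), (498736,432144), (466480,399376),
     (462448,395824), (461944,395376), (494641,428080), (461881,395312), (510993,428048),
     (413272,395800), (461913,460824), (412761,395288), (478289,395281), (478800,395280),
     (476249,394321), (476760,410704), (513552,414736), (509464,411152), (508953,476176),
     (443541,443537), (410781,410769), (443421,410641), (394429,394393), (427189,394385),
     (492573,427033), (459837,394265), (492597,394257), (458815,458809), (491575,458801),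
     (491551,458773), (507931,491537), (475227,458769), (426167,426033), (442399,426009),
     (442519,426001), (409759,409621), (409819,409625), (413907,409617), (393439,393371),
     (393469,393369), (397527,393427), (397557,393425), (397495,393361), (397431,397329),
     (393343,393233), (463474,393778), (475738,475216), (458878,393274), (462966,393330),
     (495670,458802), (508442,475160), (492062,491546), (442910,426010), (508438,426514),
     (512022,491538), (512532,507920), (479766,475152), (459358,458778), (463446,458770),
     (496692,491568), (497172,495632), (493084,491536), (459900,458808), (463988,458804),
     (464496,458800), (464468,462864), (460380,458768), (399088,393776), (394492,393272),
     (398580,393328), (394972,394328), (399060,394320), (393950,393308), (398038,393300),
     (410330,393304), (414418,393296), (443548,410640), (410270,393242), (443036,409624),
     (427676,393240), (431284,394288), (431764,394256), (430262,393264), (447124,426512),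
     (414358,393744), (446614,393232), (432291,395426), (448643,395394), (460907,395274),
     (430247,393378), (458863,393258), (497699,428066), (495655,426018), (462951,393254),
     (508430,426498), (464995,393251), (514051,428034), (507919,425994), (481347,395267),
     (473186,464994), (469602,460898), (473634,460834), (489538,464962), (489986,464898),
     (485954,460802), (471650,458786), (483914,475714), (467534,459338), (471622,459330),
     (483854,459274), (487942,459266), (520198,479238), (520195,512002), (503815,495618),
     (516103,491522), (471111,462854), (487491,462850), (483343,475142), (467023,458758),
     (483403,458754), (489537,479296), (484425,475209), (486465,475201), (470089,459841),
     (473185,464960), (469097,460865), (470120,460872), (470057,460808), (522241,479233),
     (505889,464897), (519169,477185), (502817,460801), (506912,493600), (474656,464928),
     (470624,460832), (523264,493568), (491008,464896), (486976,460800), (471141,462913),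
     (471652,471104), (464484,462912), (503845,462849), (497188,463876), (520708,479236),
     (504356,462852), (505376,462880), (521728,462848), (484936,475200), (468556,459336),
     (468580,459328), (468076,459840), (467053,458816), (517129,476161), (517640,476160),
     (516620,475648), (516109,475136), (492589,459781), (493100,492548), (468524,459780),
     (500777,459777), (501288,459776), (500268,459264), (499757,458752), (402668,394348),
     (401645,393324), (403689,393321), (404712,393320), (404649,395304), (402605,393384),
     (435245,393257), (435756,393256), (451597,425993), (404681,403464), (401615,393293),
     (417935,393231), (417995,393227), (418957,393229), (419017,401417), (412873,393225),
     (402126,393294), (418506,393290), (418446,393226), (413384,395336), (446088,395272),
     (418508,402056), (419020,401544), (419404,401480), (411340,393288), (452108,401416),
     (444044,393224), (422083,409667), (405703,393283), (454787,413699), (450695,409603),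
     (438407,393219), (454790,425986), (422534,409606), (406214,393222), (408162,393250),
     (422594,393346), (424514,393218), (401120,393888), (409184,395808), (425536,403968),
     (417472,395840), (450176,395776), (404705,403584), (425025,419904), (416961,411712),
     (400609,395456), (408673,395328), (449665,411776), (433313,395392), (441377,395296),
     (457729,395264), (431269,426144), (439844,426528), (439333,426016), (407140,393760),
     (402661,401568), (406629,401440), (398565,393248), (454789,434304), (455685,434177),
     (447621,425985), (419013,402560), (414917,394369), (422981,394241), (422085,393217),
     (448132,426112), (415428,394368), (422596,393344), (456196,425984), (423492,393216),
     (292037,278597), (292548,282692), (324741,282629), (325380,325124), (324996,324612),
     (317316,316420), (292740,283652), (323974,323716), (389892,324100), (389382,323588),
     (357126,356356), (291718,290820), (348950,348678), (381716,348676), (381206,348164),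
     (316308,315908), (315798,315396), (283542,282628), (347225,263249), (355401,328769),
     (289993,263241), (294081,279617), (377622,344084), (358467,348224), (372999,372742),
     (340295,339975), (342339,340035), (334179,333891), (342369,333889), (342370,333888),
     (326785,283649), (365334,327956), (391171,348161), (325763,315393), (332135,331843),
     (340325,331841), (299926,266516), (340326,332096), (309124,267524), (308102,266628),
     (293059,290817), (274791,266564), (294592,283712), (364839,331783), (373029,331781),
     (293570,290880), (340582,340032), (340774,339974), (373540,339972), (275685,263237),
     (342818,340002), (359170,340482), (293762,291330), (277346,276514), (277442,276994),
     (294784,291456), (278464,277120), (278368,277056), (270304,269888), (277857,276576),
     (269793,269408), (277953,269376), (307495,266501), (308006,274692), (308389,267269),
     (275937,267329), (307367,299013), (276448,267584), (276196,275520), (308900,275460),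
     (307878,307204), (275174,274948), (274663,274436), (384528,283664), (392704,349184),
     (327424,292352), (391936,291328), (327040,291840), (391426,356352), (326018,290816),
     (275426,275008), (308130,274946), (309152,275072), (376576,309760), (343840,276992),
     (374560,274944), (274915,274528), (276931,274496), (375043,339970), (375841,305184),
     (343329,276512), (376065,342016), (309635,276482), (310657,276480), (374049,339968),
     (307619,274434), (308641,274432), (304038,303618), (347736,279632), (303527,303138),
     (380440,280080), (379929,345104), (346203,327761), (354379,344129), (388105,345089),
     (385287,368646), (352527,352263), (377103,344071), (385293,344069), (385291,344321),
     (387083,352257), (314521,281616), (322697,281601), (319879,303110), (288971,286785),
     (321675,288769), (319883,319491), (321930,319618), (305547,303234), (313739,295050),
     (301235,264354), (317842,315522), (301459,301186), (313747,297090), (285075,264338),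
     (285123,268419), (285137,284801), (285011,284673), (283091,282625), (383250,315394),
     (350994,348162), (383760,348160), (285634,268418), (283602,282754), (285522,282626),
     (285648,282688), (318352,282640), (319360,282624), (366883,331779), (268659,268355),
     (301363,268291), (366898,301058), (334642,333826), (269170,268290), (302257,297120),
     (367665,298016), (366897,301088), (335153,333857), (335664,333856), (367889,333825),
     (368400,333824), (269296,268864), (268785,268352), (302992,301568), (270256,268800),
     (302481,301056), (269745,268288), (266487,266245), (266739,266305), (299443,266243),
     (300465,266369), (365873,266241), (267250,266560), (268020,267456), (266998,266432),
     (299702,266374), (300724,266372), (300976,267392), (299954,266368), (366384,267520),
     (365350,266500), (365362,266496), (333428,267328), (332406,266304), (366132,267264),
     (365110,266240), (387338,319490), (388616,377856), (338786,272418), (339808,272928),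
     (289730,264834), (387848,387072), (323336,322048), (372488,305664), (356104,272904),
     (355138,272898), (356160,338432), (290752,272896), (336742,335906), (271334,270882),
     (287438,270984), (287686,270978), (353094,271106), (352846,270850), (385804,385024),
     (321292,320000), (369452,369156), (370472,369152), (304940,303624), (337708,270888),
     (354060,271112), (353868,270856), (354116,352768), (288708,287232), (337764,336384),
     (272356,270912), (305060,270848), (304549,303264), (320901,303236), (320781,319492),
     (304429,304132), (368941,303108), (262399,262229), (270575,262341), (336237,335909),
     (336207,335877), (270703,270405), (287119,286723), (270767,270343), (270830,270374),
     (287182,270470), (352590,270342), (337260,335908), (353612,335876), (288141,286725),
     (288204,286724), (271789,270341), (271852,270340), (354634,352258), (289226,286722),
     (370955,303106), (338251,335874), (272843,272386), (270827,270338), (355656,352256),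
     (290248,286784), (322952,288768), (320905,286720), (306569,303232), (371977,305152),
     (369961,303104), (273889,263233), (273896,271552), (339304,271424), (339241,336896),
     (273833,271360), (338281,335872), (272873,270336), (281035,264322), (295862,295554),
     (263158,262818), (279262,262794), (279510,262786), (279003,278723), (262651,262339),
     (262654,262370), (279006,262338), (262591,262314), (278943,262282), (311703,278658),
     (295351,262274), (328047,262213), (377614,376836), (311583,278535), (312094,311302),
     (344910,344070), (279390,278534), (360751,327941), (361262,360708), (328558,327942),
     (328318,327750), (263038,262214), (295742,262918), (295231,262406), (361022,262662),
     (360511,262150), (378907,344065), (379666,344336), (379418,376848), (379658,376832),
     (330091,327745), (346714,344080), (346954,344066), (330602,328002), (330362,327746),
     (264571,262243), (265082,262242), (280923,262211), (281434,262210), (313627,278531),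
     (314138,278530), (297275,262419), (362555,262163), (363314,327954), (363066,327698),
     (297786,262162), (363306,262658), (362795,262146), (361533,327685), (362044,360452),
     (362809,296993), (361785,360481), (363801,360449), (363320,296992), (362296,360480),
     (364312,360448), (331065,327681), (329340,327700), (330616,264744), (331128,329768),
     (331632,329760), (329592,327728), (331608,327696), (329580,327712), (347976,329728),
     (345932,327680), (281049,278593), (313753,280577), (298393,296961), (312729,295049),
     (312605,311305), (279965,278537), (312725,278529), (315272,314368), (314264,313344),
     (282568,281600), (281560,280576), (279516,278608), (312220,279056), (312732,278544),
     (313228,311296), (280524,278528), (264697,262209), (265657,264193), (266224,264736),
     (265720,264224), (266200,264256), (298904,264192), (263164,262484), (263932,262228),
     (264172,262212), (264184,262208), (296253,294921), (296373,294913), (263613,262145),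
     (296876,263940), (295868,262916), (296636,262660), (296888,262656)])"
  by (simp only: certificate_simps)

theorem theorem4:
  shows "(\<forall>k::nat. 4 \<le> k \<and> k \<le> 11 \<longrightarrow>
            (\<exists>(K :: nat set set) I. nearly_neighborly_cs_sphere 3 K I \<and>
               card (vertices K) = 2 * k \<and> cyclic_vertex_transitive K I))
       \<and> (\<forall>(d, n) \<in> {(5, 14), (5, 16), (7, 18)}.
            (\<exists>(K :: nat set set) I. nearly_neighborly_cs_sphere d K I \<and>
               card (vertices K) = n \<and> cyclic_vertex_transitive K I))
       \<and> (\<forall>(d, n) \<in> {(4, 12), (4, 14), (6, 16)}.
            \<not> (\<exists>(K :: 'a set set) I. nearly_neighborly_cs_sphere d K I \<and>
               card (vertices K) = n \<and> cyclic_vertex_transitive K I))"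
proof (intro conjI)
  have sphere: "\<exists>(K :: nat set set) I. nearly_neighborly_cs_sphere d K I \<and>
      card (vertices K) = n \<and> cyclic_vertex_transitive K I"
    if "sphere_certificate k l F xs" "0 < l" "d = 2 * l - 1" "n = 2 * k" for k l F xs d n
    using sphere_certificate_imp_sphere[OF that(1,2)] that(3,4) by blast
  show "\<forall>k::nat. 4 \<le> k \<and> k \<le> 11 \<longrightarrow>
      (\<exists>(K :: nat set set) I. nearly_neighborly_cs_sphere 3 K I \<and>
         card (vertices K) = 2 * k \<and> cyclic_vertex_transitive K I)"
  proof (intro allI impI)
    fix k :: nat
    assume "4 \<le> k \<and> k \<le> 11"
    then consider "k = 4" | "k = 5" | "k = 6" | "k = 7" | "k = 8" | "k = 9" | "k = 10" | "k = 11"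
      by linarith
    then obtain F xs where "sphere_certificate k 2 F xs"
      using sphere_certificate_3_8 sphere_certificate_3_10 sphere_certificate_3_12
        sphere_certificate_3_14 sphere_certificate_3_16 sphere_certificate_3_18
        sphere_certificate_3_20 sphere_certificate_3_22 by cases blast+
    then show "\<exists>(K :: nat set set) I. nearly_neighborly_cs_sphere 3 K I \<and>
         card (vertices K) = 2 * k \<and> cyclic_vertex_transitive K I"
      by (rule sphere) simp_all
  qed
  show "\<forall>(d, n) \<in> {(5, 14), (5, 16), (7, 18)}.
      (\<exists>(K :: nat set set) I. nearly_neighborly_cs_sphere d K I \<and>
         card (vertices K) = n \<and> cyclic_vertex_transitive K I)"
    using sphere[OF sphere_certificate_5_14, of 5 14] sphere[OF sphere_certificate_5_16, of 5 16]
      sphere[OF sphere_certificate_7_18, of 7 18]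
    by simp
  show "\<forall>(d, n) \<in> {(4, 12), (4, 14), (6, 16)}.
      \<not> (\<exists>(K :: 'a set set) I. nearly_neighborly_cs_sphere d K I \<and>
         card (vertices K) = n \<and> cyclic_vertex_transitive K I)"
  proof -
    \<comment> \<open>This settles n = 12 and n = 16, both divisible by 4; n = 14 is left to the
      bound on the size of a face.\<close>
    have "False" if "nearly_neighborly_cs_sphere d K I" "cyclic_vertex_transitive K I"
        "even d" "4 dvd card (vertices K)" for d K and I :: "'a \<Rightarrow> 'a"
      using that no_cyclic_cs_sphere_4_dvd[of d K I] unfolding nearly_neighborly_cs_sphere_def by blast
    moreover have "False" if "nearly_neighborly_cs_sphere 4 K I" "cyclic_vertex_transitive K I"
        "card (vertices K) = 14" for K and I :: "'a \<Rightarrow> 'a"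
      using that no_cyclic_sphere_4_14[of K I] unfolding nearly_neighborly_cs_sphere_def by blast
    ultimately show ?thesis
      by fastforce
  qed
qed

end
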